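(* Let $p\ge2$, let $K\subset\mathbb S^{p-1}$ be compact with one-dimensional Hausdorff measure $\mathcal H^1(K)=0$, and let $\mu$ be a Borel probability measure supported on $K$. Then the orthogonality shadow $\mathcal O(K)$ is Haar-null, and the following hold. (1) For $U$ uniformly distributed on $\mathbb S^{p-1}$, $u^\top g_\mu(u)=1$ wherever $g_\mu$ is defined, and $H_\mu(U)=\{U^\top N_\mu(U)\}^2\sim\mathrm{Beta}\bigl(\tfrac12,\tfrac{p-1}2\bigr)$. (2) On the open cone $\Omega_K:=\{x\in\mathbb R^p:\min_{a\in K}|a^\top x|>0\}$, the function $$\Phi_\mu(x):=\exp\Bigl\{\int_K\log|a^\top x|\,\mu(\mathrm da)\Bigr\}$$ is smooth and positively homogeneous of degree one, and $\nabla\log\Phi_\mu(x)=g_\mu(x)$. (3) For Haar-almost every $u\in\mathbb S^{p-1}$, $H_\mu(u)$ is both the squared incidence cosine $\{u^\top N_\mu(u)\}^2$ and the squared distance from the origin to the tangent hyperplane at $u$ of the level hypersurface of $\Phi_\mu$ through $u$.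
   Context: $\mathcal O(K):=\{u\in\mathbb S^{p-1}:a^\top u=0\text{ for some }a\in K\}$. For $x\in\mathbb R^p$ with $\int|a^\top x|^{-1}\mu(\mathrm da)<\infty$ (integrand $+\infty$ when $a^\top x=0$), $g_\mu(x):=\int\frac a{a^\top x}\,\mu(\mathrm da)$; for such $u\in\mathbb S^{p-1}$, $N_\mu(u):=g_\mu(u)/\|g_\mu(u)\|$ and $H_\mu(u):=1/\|g_\mu(u)\|^2$. Almost everywhere finiteness of $\int|a^\top u|^{-1}\mu(\mathrm da)$ on the sphere is part of conclusion (1). *)

theory Defs
  imports "HOL-Probability.Probability"
begin

text \<open>
  One-dimensional Hausdorff (outer) measure. The covering sets are required to be bounded because
  \<^const>\<open>diameter\<close> takes an unspecified real value on unbounded sets.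
\<close>

definition hausdorff1_pre :: "real \<Rightarrow> 'a::metric_space set \<Rightarrow> ennreal" where
  "hausdorff1_pre \<delta> A =
     (INF C \<in> {C :: nat \<Rightarrow> 'a set. A \<subseteq> (\<Union>i. C i) \<and> (\<forall>i. bounded (C i) \<and> diameter (C i) \<le> \<delta>)}.
        \<Sum>i. ennreal (diameter (C i)))"

definition hausdorff1 :: "'a::metric_space set \<Rightarrow> ennreal" where
  "hausdorff1 A = (SUP \<delta> \<in> {0<..}. hausdorff1_pre \<delta> A)"

text \<open>
  The uniform (Haar) probability measure on the unit sphere, as a Borel measure on the ambient
  space: the law of the direction of a uniformly distributed point of the unit ball. The lemmas
  below confirm that it is a probability measure carried by the sphere and invariant under all
  orthogonal transformations.
\<close>

definition uniform_sphere :: "'a::euclidean_space measure" where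
  "uniform_sphere = distr (uniform_measure lborel (ball 0 1)) borel (\<lambda>x. x /\<^sub>R norm x)"

lemma sets_uniform_sphere [simp, measurable_cong]: "sets uniform_sphere = sets borel"
  by (simp add: uniform_sphere_def)

lemma space_uniform_sphere [simp]: "space uniform_sphere = UNIV"
  by (simp add: uniform_sphere_def)

lemma emeasure_unit_ball:
  "emeasure lborel (ball (0::'a::euclidean_space) 1) \<noteq> 0"
  "emeasure lborel (ball (0::'a::euclidean_space) 1) \<noteq> \<infinity>"
proof -
  have "unit_ball_vol (real DIM('a)) \<noteq> 0"
    by (rule less_imp_neq[symmetric], rule unit_ball_vol_pos) simp
  then show "emeasure lborel (ball (0::'a) 1) \<noteq> 0" "emeasure lborel (ball (0::'a) 1) \<noteq> \<infinity>"
    by (auto simp: emeasure_ball)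
qed

lemma uniform_ball_prob_space:
  "prob_space (uniform_measure lborel (ball (0::'a::euclidean_space) 1))"
  by (rule prob_space_uniform_measure[OF emeasure_unit_ball])

lemma prob_space_uniform_sphere: "prob_space (uniform_sphere :: 'a::euclidean_space measure)"
  unfolding uniform_sphere_def
  by (rule prob_space.prob_space_distr[OF uniform_ball_prob_space]) simp

lemma AE_uniform_sphere_mem_sphere:
  "AE u in (uniform_sphere :: 'a::euclidean_space measure). u \<in> sphere 0 1"
proof -
  have "AE x in (lborel :: 'a measure). x \<noteq> 0"
    by (rule AE_lborel_singleton)
  then have "AE x in uniform_measure lborel (ball (0::'a) 1). x /\<^sub>R norm x \<in> sphere 0 1"
    by (intro AE_uniform_measureI) auto
  then show ?thesis
    unfolding uniform_sphere_def by (subst AE_distr_iff) auto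
qed

lemma lborel_orthogonal_invariant:
  fixes f :: "'a::euclidean_space \<Rightarrow> 'a"
  assumes f: "orthogonal_transformation f"
  shows "distr lborel borel f = lborel"
proof (rule measure_eqI)
  have lin: "linear f"
    using f by (rule orthogonal_transformation_linear)
  have f_meas [measurable]: "f \<in> borel_measurable borel"
    using lin by (intro borel_measurable_continuous_onI linear_continuous_on)
      (simp add: linear_conv_bounded_linear)
  let ?N = "distr lborel borel f" and ?B = "ball (0::'a) 1"
  have B_meas [measurable]: "?B \<in> sets borel" by simp
  let ?b = "emeasure (lborel :: 'a measure) ?B"
  fix A :: "'a set" assume "A \<in> sets ?N"
  then have A [measurable]: "A \<in> sets borel" by simp
  have shift: "(\<integral>\<^sup>+x. h (x + t) \<partial>lborel) = (\<integral>\<^sup>+x. h x \<partial>lborel)"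
    if [measurable]: "h \<in> borel_measurable borel" for h :: "'a \<Rightarrow> ennreal" and t
  proof -
    have "(\<integral>\<^sup>+x. h x \<partial>lborel) = (\<integral>\<^sup>+x. h x \<partial>distr lborel borel ((+) t))"
      by (simp add: lborel_distr_plus)
    then show ?thesis
      by (simp add: nn_integral_distr add.commute)
  qed
  have vim: "f x + y \<in> ball 0 1 \<longleftrightarrow> x + inv f y \<in> ball 0 1" for x y
  proof -
    have "norm (f x + y) = norm (f (x + inv f y))"
      using linear_add[OF lin] f by (simp add: orthogonal_transformation_surj surj_f_inv_f)
    also have "\<dots> = norm (x + inv f y)"
      using f by (rule orthogonal_transformation_norm)
    finally show ?thesis by simp
  qed
  have "emeasure ?N A * ?b = (\<integral>\<^sup>+y. (\<integral>\<^sup>+x. indicator A (f x) * indicator ?B y \<partial>lborel) \<partial>lborel)"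
  proof -
    have "emeasure ?N A = (\<integral>\<^sup>+x. indicator A (f x) \<partial>lborel)"
      by (simp add: nn_integral_distr flip: nn_integral_indicator)
    then show ?thesis
      by (simp add: nn_integral_multc nn_integral_cmult_indicator)
  qed
  also have "\<dots> = (\<integral>\<^sup>+y. (\<integral>\<^sup>+x. indicator A (f x + y) * indicator ?B y \<partial>lborel) \<partial>lborel)"
  proof (rule nn_integral_cong)
    fix y :: 'a
    have "f (x + inv f y) = f x + y" for x
      using linear_add[OF lin] f by (simp add: orthogonal_transformation_surj surj_f_inv_f)
    then show "(\<integral>\<^sup>+x. indicator A (f x) * indicator ?B y \<partial>lborel)
      = (\<integral>\<^sup>+x. indicator A (f x + y) * indicator ?B y \<partial>lborel)"
      using shift[of "\<lambda>x. indicator A (f x) * indicator ?B y" "inv f y"] by simp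
  qed
  also have "\<dots> = (\<integral>\<^sup>+x. (\<integral>\<^sup>+y. indicator A (f x + y) * indicator ?B y \<partial>lborel) \<partial>lborel)"
    by (rule lborel_pair.Fubini') measurable
  also have "\<dots> = (\<integral>\<^sup>+x. (\<integral>\<^sup>+y. indicator A y * indicator ?B (y - f x) \<partial>lborel) \<partial>lborel)"
  proof (rule nn_integral_cong)
    fix x :: 'a
    show "(\<integral>\<^sup>+y. indicator A (f x + y) * indicator ?B y \<partial>lborel)
      = (\<integral>\<^sup>+y. indicator A y * indicator ?B (y - f x) \<partial>lborel)"
      using shift[of "\<lambda>y. indicator A y * indicator ?B (y - f x)" "f x"]
      by (simp add: add.commute)
  qed
  also have "\<dots> = (\<integral>\<^sup>+y. (\<integral>\<^sup>+x. indicator A y * indicator ?B (y - f x) \<partial>lborel) \<partial>lborel)"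
    by (rule lborel_pair.Fubini') measurable
  also have "\<dots> = (\<integral>\<^sup>+y. indicator A y * ?b \<partial>lborel)"
  proof (rule nn_integral_cong)
    fix y :: 'a
    have "indicator ?B (y - f x) = (indicator ?B (x + inv f (- y)) :: ennreal)" for x
      using vim[of x "- y"] by (simp add: indicator_def norm_minus_commute)
    then have "(\<integral>\<^sup>+x. indicator ?B (y - f x) \<partial>lborel) = ?b"
      using shift[of "indicator ?B" "inv f (- y)"] by simp
    then show "(\<integral>\<^sup>+x. indicator A y * indicator ?B (y - f x) \<partial>lborel) = indicator A y * ?b"
      by (simp add: nn_integral_cmult)
  qed
  also have "\<dots> = emeasure lborel A * ?b"
    by (simp add: nn_integral_multc)
  finally have "emeasure ?N A * ?b = emeasure lborel A * ?b" .
  moreover have "?b \<noteq> 0" "?b \<noteq> \<top>"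
    using emeasure_unit_ball by auto
  ultimately show "emeasure ?N A = emeasure lborel A"
    using ennreal_mult_divide_eq[of ?b] by metis
qed simp

lemma uniform_sphere_orthogonal_invariant:
  fixes f :: "'a::euclidean_space \<Rightarrow> 'a"
  assumes f: "orthogonal_transformation f"
  shows "distr uniform_sphere borel f = uniform_sphere"
proof -
  have lin: "linear f"
    using f by (rule orthogonal_transformation_linear)
  have f_meas [measurable]: "f \<in> borel_measurable borel"
    using lin by (intro borel_measurable_continuous_onI linear_continuous_on)
      (simp add: linear_conv_bounded_linear)
  let ?B = "ball (0::'a) 1"
  have inv: "distr (uniform_measure lborel ?B) borel f = uniform_measure lborel ?B"
  proof (rule measure_eqI)
    fix A assume "A \<in> sets (distr (uniform_measure lborel ?B) borel f)"
    then have A [measurable]: "A \<in> sets borel" by simp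
    have "?B \<inter> f -` A = f -` (?B \<inter> A)"
      using f by (auto simp: orthogonal_transformation_norm)
    then have "emeasure lborel (?B \<inter> f -` A) = emeasure (distr lborel borel f) (?B \<inter> A)"
      by (subst emeasure_distr) auto
    moreover have "f -` A \<in> sets borel"
      using measurable_sets[OF f_meas A] by simp
    ultimately show "emeasure (distr (uniform_measure lborel ?B) borel f) A
      = emeasure (uniform_measure lborel ?B) A"
      by (subst emeasure_distr) (auto simp: lborel_orthogonal_invariant[OF f])
  qed simp
  have "f (x /\<^sub>R norm x) = f x /\<^sub>R norm (f x)" for x
    using f linear_scale[OF lin] by (simp add: orthogonal_transformation_norm)
  then have "distr uniform_sphere borel f
    = distr (distr (uniform_measure lborel ?B) borel f) borel (\<lambda>x. x /\<^sub>R norm x)"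
    unfolding uniform_sphere_def by (simp add: distr_distr o_def)
  then show ?thesis
    unfolding inv by (simp add: uniform_sphere_def)
qed

definition beta_density :: "real \<Rightarrow> real \<Rightarrow> real \<Rightarrow> real" where
  "beta_density \<alpha> \<beta> x =
     (if 0 < x \<and> x < 1 then x powr (\<alpha> - 1) * (1 - x) powr (\<beta> - 1) / Beta \<alpha> \<beta> else 0)"

definition orthogonality_shadow :: "'a::euclidean_space set \<Rightarrow> 'a set" where
  "orthogonality_shadow K = {u \<in> sphere 0 1. \<exists>a\<in>K. a \<bullet> u = 0}"

text \<open>
  In \<^typ>\<open>ennreal\<close> the inverse of 0 is infinite, which is the required value of the integrand
  where \<^term>\<open>a \<bullet> x = 0\<close>.
\<close>

definition g_defined :: "'a::euclidean_space measure \<Rightarrow> 'a \<Rightarrow> bool" where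
  "g_defined \<mu> x \<longleftrightarrow> (\<integral>\<^sup>+a. inverse (ennreal \<bar>a \<bullet> x\<bar>) \<partial>\<mu>) < \<infinity>"

text \<open>The next three functions are meaningful only at points satisfying \<^const>\<open>g_defined\<close>.\<close>

definition g_mu :: "'a::euclidean_space measure \<Rightarrow> 'a \<Rightarrow> 'a" where
  "g_mu \<mu> x = (\<integral>a. a /\<^sub>R (a \<bullet> x) \<partial>\<mu>)"

definition N_mu :: "'a::euclidean_space measure \<Rightarrow> 'a \<Rightarrow> 'a" where
  "N_mu \<mu> u = g_mu \<mu> u /\<^sub>R norm (g_mu \<mu> u)"

definition H_mu :: "'a::euclidean_space measure \<Rightarrow> 'a \<Rightarrow> real" where
  "H_mu \<mu> u = 1 / (norm (g_mu \<mu> u))\<^sup>2"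

text \<open>For compact nonempty \<open>K\<close> the infimum is attained, i.e. it is the minimum.\<close>

definition Omega :: "'a::euclidean_space set \<Rightarrow> 'a set" where
  "Omega K = {x. (INF a\<in>K. \<bar>a \<bullet> x\<bar>) > 0}"

definition Phi :: "'a::euclidean_space set \<Rightarrow> 'a measure \<Rightarrow> 'a \<Rightarrow> real" where
  "Phi K \<mu> x = exp (LINT a:K|\<mu>. ln \<bar>a \<bullet> x\<bar>)"

definition level_hypersurface :: "'a::euclidean_space set \<Rightarrow> 'a measure \<Rightarrow> 'a \<Rightarrow> 'a set" where
  "level_hypersurface K \<mu> u = {x \<in> Omega K. Phi K \<mu> x = Phi K \<mu> u}"

text \<open>\<open>k\<close> times continuously differentiable on an open set, via iterated directional derivatives.\<close>

primrec Ck_on ::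
  "nat \<Rightarrow> 'a::real_normed_vector set \<Rightarrow> ('a \<Rightarrow> 'b::real_normed_vector) \<Rightarrow> bool" where
  "Ck_on 0 S f \<longleftrightarrow> continuous_on S f"
| "Ck_on (Suc k) S f \<longleftrightarrow>
     (\<forall>x\<in>S. f differentiable (at x)) \<and> (\<forall>v. Ck_on k S (\<lambda>x. frechet_derivative f (at x) v))"

definition smooth_on :: "'a::real_normed_vector set \<Rightarrow> ('a \<Rightarrow> 'b::real_normed_vector) \<Rightarrow> bool" where
  "smooth_on S f \<longleftrightarrow> (\<forall>k. Ck_on k S f)"

text \<open>
  The affine tangent space of \<open>S\<close> at \<open>u\<close>: \<open>u\<close> plus the velocities at \<open>u\<close> of the
  continuously differentiable curves running in \<open>S\<close>.
\<close>

definition affine_tangent_space :: "'a::real_normed_vector set \<Rightarrow> 'a \<Rightarrow> 'a set" where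
  "affine_tangent_space S u =
     {u + vector_derivative \<gamma> (at 0) | \<gamma> \<epsilon>. \<epsilon> > 0 \<and> \<gamma> C1_differentiable_on {-\<epsilon><..<\<epsilon>} \<and>
        \<gamma> 0 = u \<and> \<gamma> ` {-\<epsilon><..<\<epsilon>} \<subseteq> S}"

end

theory Submission
  imports Defs "HOL-Complex_Analysis.Complex_Analysis"
begin

text \<open>
  \<^bold>\<open>The shadow is null.\<close> If \<open>a \<bullet> x = 0\<close> and \<open>b\<close> is within \<open>d\<close> of \<open>a\<close>, then
  \<open>\<bar>b \<bullet> x\<bar> \<le> d * norm x\<close>, and a slab of width \<open>d\<close> has Gaussian measure \<open>O(d)\<close>. A
  cover of \<open>K\<close> by sets whose diameters have small sum therefore gives a cover of the bounded part of
  \<open>{x. \<exists>a\<in>K. a \<bullet> x = 0}\<close> by slabs of small total measure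
  (\<open>orthogonal_directions_null\<close>). Hence almost every direction lies in \<open>Omega K\<close>, where all
  inner products with \<open>K\<close> are bounded away from 0 and everything is well behaved.

  \<^bold>\<open>The law of \<open>H_mu\<close>.\<close> Let \<open>X\<close>, \<open>Y\<close> be independent standard Gaussian vectors.
  Rotating the pair \<open>(X, Y)\<close> by an angle \<open>\<theta>\<close> (the same rotation in each coordinate plane) does
  not change its law. For a fixed pair, put \<open>\<zeta> = a \<bullet> X + \<i> a \<bullet> Y\<close>; the rotation multiplies
  \<open>\<zeta>\<close> by \<open>cis \<theta>\<close>, so the ratio \<open>(a \<bullet> Y) / (a \<bullet> X)\<close> becomes the boundary value at
  \<open>w = cis (2\<theta>)\<close> of \<open>\<i> (1 - w \<kappa>) / (1 + w \<kappa>)\<close> with \<open>\<kappa> = \<zeta> / cnj \<zeta>\<close> unimodular.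
  This function maps the unit disc into the upper half plane and sends 0 to \<open>\<i>\<close>, and both properties
  survive averaging over \<open>a\<close>. So, whatever \<open>\<mu>\<close> is, \<open>Y \<bullet> g_mu \<mu> X\<close> is the boundary value of
  such a function \<open>F\<close>, and the mean value property of \<open>exp (\<i> t F)\<close> shows that its characteristic
  function at \<open>t \<ge> 0\<close> is \<open>exp (\<i> t \<i>) = exp (- t)\<close>: it is Cauchy distributed
  (\<open>gauss_pair_char\<close>). This is the classical invariance of the Cauchy law under inner functions.

  Given \<open>X\<close>, the variable \<open>Y \<bullet> g_mu \<mu> X\<close> is centred normal with variance
  \<open>(norm (g_mu \<mu> X))\<^sup>2\<close>, so that \<open>exp (- t\<^sup>2 (norm (g_mu \<mu> X))\<^sup>2 / 2)\<close> has expectation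
  \<open>exp (- t)\<close>. Integrating this identity against odd powers of \<open>t\<close> yields all moments of
  \<open>H_mu \<mu> X = (norm X)\<^sup>2 * H_mu \<mu> (X / norm X)\<close>; they are those of a chi-squared variable with one
  degree of freedom. The direction of \<open>X\<close> is uniform and independent of \<open>norm X\<close>, so dividing by the
  moments of \<open>(norm X)\<^sup>2\<close> gives the moments of \<open>H_mu \<mu> U\<close>, which are the Beta moments
  (\<open>sphere_H_mu_moment\<close>). A law on a bounded interval is determined by its moments.

  \<^bold>\<open>Smoothness and tangent spaces.\<close> On \<open>Omega K\<close> one may differentiate under the integral, and
  the functions produced by differentiating \<open>Phi K \<mu>\<close> again and again stay in a class that is closed
  under differentiation (\<open>Phi_class_derivative\<close>). Since \<open>u \<bullet> g_mu \<mu> u = 1\<close>, the gradient of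
  \<open>ln \<circ> Phi K \<mu>\<close> vanishes nowhere, and the homogeneity of \<open>Phi K \<mu>\<close> provides explicit
  curves in its level sets: rescaling the segment \<open>u + t *\<^sub>R v\<close> into the level set gives a curve with velocity \<open>v\<close> for every \<open>v\<close>
  orthogonal to \<open>g_mu \<mu> u\<close>. The tangent space is thus the hyperplane \<open>{y. g_mu \<mu> u \<bullet> y = 1}\<close>,
  at distance \<open>1 / norm (g_mu \<mu> u)\<close> from the origin.
\<close>

section \<open>Standard Gaussian vectors\<close>

definition gauss_density :: "'a::euclidean_space \<Rightarrow> real" where
  "gauss_density x = (\<Prod>b\<in>Basis. std_normal_density (x \<bullet> b))"

definition gauss :: "'a::euclidean_space measure" where
  "gauss = density lborel (\<lambda>x. ennreal (gauss_density x))"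

lemma gauss_density_pos: "0 < gauss_density x"
  unfolding gauss_density_def by (intro prod_pos) (simp add: normal_density_pos)

lemma gauss_density_measurable [measurable]: "gauss_density \<in> borel_measurable borel"
  unfolding gauss_density_def by measurable

lemma gauss_density_norm:
  "gauss_density (x::'a::euclidean_space) = exp (- (norm x)\<^sup>2 / 2) / sqrt (2 * pi) ^ DIM('a)"
proof -
  have "(norm x)\<^sup>2 = (\<Sum>b\<in>Basis. (x \<bullet> b)\<^sup>2)"
    by (subst power2_norm_eq_inner, subst euclidean_inner) (simp add: power2_eq_square)
  then show ?thesis
    unfolding gauss_density_def std_normal_density_def
    by (simp add: exp_sum[symmetric] sum_negf sum_divide_distrib prod_dividef divide_simps)
qed

lemma sets_gauss [simp, measurable_cong]: "sets gauss = sets borel"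
  by (simp add: gauss_def)

lemma space_gauss [simp]: "space gauss = UNIV"
  by (simp add: gauss_def)

text \<open>
  The factor at \<open>b\<close> depends on \<open>b\<close> through the coordinate \<open>v \<bullet> b\<close> of a fixed vector, as in
  the characteristic function of a Gaussian vector at \<open>v\<close>.
\<close>

lemma lborel_integral_prod_Basis:
  fixes f :: "real \<Rightarrow> real \<Rightarrow> complex"
  assumes "\<And>c. integrable lborel (f c)"
  shows "integrable lborel (\<lambda>x::'a::euclidean_space. \<Prod>b\<in>Basis. f (v \<bullet> b) (x \<bullet> b))"
    and "(\<integral>(x::'a). (\<Prod>b\<in>Basis. f (v \<bullet> b) (x \<bullet> b)) \<partial>lborel) = (\<Prod>b\<in>Basis. (\<integral>s. f (v \<bullet> b) s \<partial>lborel))"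
proof -
  interpret product_sigma_finite "\<lambda>b::'a. lborel :: real measure" ..
  have lb: "(lborel :: 'a measure) = distr (\<Pi>\<^sub>M b\<in>Basis. lborel) borel (\<lambda>f. \<Sum>b\<in>Basis. f b *\<^sub>R b)"
    unfolding lborel_def[where 'a='a] lborel_eq_real ..
  have [measurable]: "f c \<in> borel_measurable borel" for c
    using borel_measurable_integrable[OF assms[of c]] by simp
  have co: "(\<Prod>b\<in>Basis. f (v \<bullet> b) ((\<Sum>c\<in>Basis. h c *\<^sub>R c) \<bullet> b)) = (\<Prod>b\<in>Basis. f (v \<bullet> b) (h b))" for h :: "'a \<Rightarrow> real"
    by (intro prod.cong refl) (simp add: inner_sum_left_Basis)
  show "integrable lborel (\<lambda>x::'a. \<Prod>b\<in>Basis. f (v \<bullet> b) (x \<bullet> b))"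
    unfolding lb by (subst integrable_distr_eq) (auto simp: co intro!: product_integrable_prod assms)
  show "(\<integral>(x::'a). (\<Prod>b\<in>Basis. f (v \<bullet> b) (x \<bullet> b)) \<partial>lborel) = (\<Prod>b\<in>Basis. (\<integral>s. f (v \<bullet> b) s \<partial>lborel))"
    unfolding lb by (subst integral_distr) (auto simp: co intro!: product_integral_prod assms)
qed

lemma char_gauss:
  fixes v :: "'a::euclidean_space"
  shows "integrable lborel (\<lambda>x::'a. gauss_density x *\<^sub>R iexp (x \<bullet> v))"
    and "(\<integral>(x::'a). gauss_density x *\<^sub>R iexp (x \<bullet> v) \<partial>lborel) = exp (- (norm v)\<^sup>2 / 2)"
proof -
  define f where "f c s = std_normal_density s *\<^sub>R iexp (c * s)" for c s
  interpret real_distribution std_normal_distribution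
    by (rule real_dist_normal_dist)
  have int: "integrable lborel (f c)" for c
  proof -
    have "integrable std_normal_distribution (\<lambda>s. iexp (c * s))"
      by (rule integrable_iexp) auto
    then show ?thesis
      unfolding f_def by (subst (asm) integrable_density) auto
  qed
  have val: "(\<integral>s. f c s \<partial>lborel) = exp (- c\<^sup>2 / 2)" for c
  proof -
    have "(\<integral>s. f c s \<partial>lborel) = char std_normal_distribution c"
      unfolding f_def char_def by (subst integral_density) auto
    then show ?thesis by (simp add: char_std_normal_distribution exp_of_real[symmetric])
  qed
  have eq: "gauss_density x *\<^sub>R iexp (x \<bullet> v) = (\<Prod>b\<in>Basis. f (v \<bullet> b) (x \<bullet> b))" for x :: 'a
  proof -
    have "iexp (x \<bullet> v) = (\<Prod>b\<in>Basis. iexp ((v \<bullet> b) * (x \<bullet> b)))"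
      by (simp add: exp_sum[symmetric] sum_distrib_left[symmetric] euclidean_inner[of x v] mult.commute
          flip: of_real_sum of_real_mult)
    then show ?thesis
      by (simp add: f_def gauss_density_def scaleR_conv_of_real prod.distrib)
  qed
  have n: "(norm v)\<^sup>2 = (\<Sum>b\<in>Basis. (v \<bullet> b)\<^sup>2)"
    by (subst power2_norm_eq_inner, subst euclidean_inner) (simp add: power2_eq_square)
  show "integrable lborel (\<lambda>x::'a. gauss_density x *\<^sub>R iexp (x \<bullet> v))"
    unfolding eq by (rule lborel_integral_prod_Basis(1)[where f=f, OF int])
  show "(\<integral>(x::'a). gauss_density x *\<^sub>R iexp (x \<bullet> v) \<partial>lborel) = exp (- (norm v)\<^sup>2 / 2)"
  proof -
    have "- (norm v)\<^sup>2 / 2 = (\<Sum>b\<in>Basis. - (v \<bullet> b)\<^sup>2 / 2)"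
      by (simp add: n sum_negf sum_divide_distrib)
    then have "complex_of_real (exp (- (norm v)\<^sup>2 / 2)) = (\<Prod>b\<in>Basis. complex_of_real (exp (- (v \<bullet> b)\<^sup>2 / 2)))"
      by (simp only: exp_sum[OF finite_Basis] of_real_prod)
    then show ?thesis
      unfolding eq using lborel_integral_prod_Basis(2)[where f=f and v=v, OF int] by (simp add: val)
  qed
qed

lemma gauss_integral_iexp:
  "(\<integral>x. iexp (x \<bullet> v) \<partial>gauss) = exp (- (norm v)\<^sup>2 / 2)"
  unfolding gauss_def
  by (subst integral_density) (auto simp: char_gauss(2) less_imp_le[OF gauss_density_pos])

lemma prob_space_gauss: "prob_space (gauss :: 'a::euclidean_space measure)"
proof
  have "integrable lborel (\<lambda>x::'a. complex_of_real (gauss_density x))"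
    "(\<integral>(x::'a). complex_of_real (gauss_density x) \<partial>lborel) = 1"
    using char_gauss[of "0::'a"] by (simp_all add: scaleR_conv_of_real)
  then have "has_bochner_integral lborel (gauss_density :: 'a \<Rightarrow> real) 1"
    by (simp add: has_bochner_integral_iff complex_of_real_integrable_eq)
  then have "(\<integral>\<^sup>+x. ennreal (gauss_density (x::'a)) \<partial>lborel) = 1"
    by (subst nn_integral_eq_integral)
       (auto simp: has_bochner_integral_iff less_imp_le[OF gauss_density_pos])
  then show "emeasure (gauss :: 'a measure) (space gauss) = 1"
    by (simp add: gauss_def emeasure_density)
qed

text \<open>
  Two independent standard Gaussian vectors form one standard Gaussian vector of the product space, whose
  orthogonal invariance then covers rotations that mix the two.
\<close>

lemma gauss_pair: "(gauss :: 'a::euclidean_space measure) \<Otimes>\<^sub>M (gauss :: 'b::euclidean_space measure) = gauss"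
proof -
  have "gauss_density (x, y) = gauss_density x * gauss_density y" for x :: 'a and y :: 'b
    by (simp add: gauss_density_norm norm_Pair power_add exp_add[symmetric] add_divide_distrib)
  then have "ennreal (gauss_density (x, y)) = ennreal (gauss_density x) * ennreal (gauss_density y)" for x :: 'a and y :: 'b
    by (simp add: ennreal_mult less_imp_le[OF gauss_density_pos])
  then have d: "(\<lambda>z::'a \<times> 'b. ennreal (gauss_density z))
    = (\<lambda>(x, y). ennreal (gauss_density x) * ennreal (gauss_density y))"
    by auto
  interpret prob_space "gauss :: 'b measure" by (rule prob_space_gauss)
  show ?thesis
    unfolding gauss_def d lborel_prod[symmetric]
    using sigma_finite_measure_axioms
    by (intro pair_measure_density) (auto simp: gauss_def lborel.sigma_finite_measure_axioms)
qed

lemma gauss_orthogonal_invariant: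
  fixes f :: "'a::euclidean_space \<Rightarrow> 'a"
  assumes f: "orthogonal_transformation f"
  shows "distr gauss borel f = gauss"
proof -
  have [measurable]: "f \<in> borel_measurable borel"
    using orthogonal_transformation_linear[OF f]
    by (intro borel_measurable_continuous_onI linear_continuous_on)
      (simp add: linear_conv_bounded_linear)
  have "gauss = density (distr lborel borel f) (\<lambda>x::'a. ennreal (gauss_density x))"
    by (simp add: gauss_def lborel_orthogonal_invariant[OF f])
  also have "\<dots> = distr (density lborel (\<lambda>x. ennreal (gauss_density (f x)))) borel f"
    by (rule density_distr) auto
  also have "(\<lambda>x. ennreal (gauss_density (f x))) = (\<lambda>x. ennreal (gauss_density x))"
    using f by (simp add: gauss_density_norm orthogonal_transformation_norm)
  finally show ?thesis by (simp add: gauss_def)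
qed

lemma nn_integral_lborel_scale:
  fixes h :: "'a::euclidean_space \<Rightarrow> ennreal"
  assumes [measurable]: "h \<in> borel_measurable borel" and c: "c > 0"
  shows "(\<integral>\<^sup>+x. h x \<partial>lborel) = ennreal (c ^ DIM('a)) * (\<integral>\<^sup>+x. h (c *\<^sub>R x) \<partial>lborel)"
proof -
  have "(\<integral>\<^sup>+x. h x \<partial>lborel)
    = (\<integral>\<^sup>+x. h x \<partial>density (distr lborel borel (\<lambda>x. 0 + c *\<^sub>R x)) (\<lambda>_. ennreal (\<bar>c\<bar> ^ DIM('a))))"
    using lborel_affine[of c "0::'a"] c by simp
  then show ?thesis
    using c by (simp add: nn_integral_density nn_integral_distr nn_integral_cmult)
qed

text \<open>
  Integration in polar coordinates. Both sides, as functions of \<open>q\<close>, are integrals against a measure on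
  the line; scaling the ball of radius \<open>r\<close> to the unit ball shows that the two measures agree on
  \<open>{norm x < r}\<close>. Passing to \<open>- norm x\<close> turns these balls into preimages of upper half lines, and
  the finite values there determine a measure on the line.
\<close>

lemma nn_integral_polar:
  fixes f :: "'a::euclidean_space \<Rightarrow> ennreal" and q :: "real \<Rightarrow> ennreal"
  assumes [measurable]: "f \<in> borel_measurable borel" "q \<in> borel_measurable borel"
    and f1: "\<And>x. f x \<le> 1"
  shows "(\<integral>\<^sup>+x. f (x /\<^sub>R norm x) * q (norm x) \<partial>lborel)
    = (\<integral>\<^sup>+u. f u \<partial>uniform_sphere) * (\<integral>\<^sup>+(x::'a). q (norm x) \<partial>lborel)"
proof -
  define \<sigma> where "\<sigma> = (\<integral>\<^sup>+u. f u \<partial>uniform_sphere)"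
  let ?B = "ball (0::'a) 1"
  have \<sigma>: "(\<integral>\<^sup>+x. f (x /\<^sub>R norm x) * indicator ?B x \<partial>lborel) = \<sigma> * emeasure lborel ?B"
  proof -
    have "\<sigma> = (\<integral>\<^sup>+x. f (x /\<^sub>R norm x) \<partial>uniform_measure lborel ?B)"
      unfolding \<sigma>_def uniform_sphere_def by (subst nn_integral_distr) auto
    also have "\<dots> = (\<integral>\<^sup>+x. f (x /\<^sub>R norm x) * indicator ?B x \<partial>lborel) / emeasure lborel ?B"
      by (subst nn_integral_uniform_measure) auto
    finally show ?thesis
      using emeasure_unit_ball[where 'a='a]
      by (simp add: ennreal_divide_times ennreal_divide_self less_top)
  qed
  have ball: "(\<integral>\<^sup>+x. f (x /\<^sub>R norm x) * indicator {s<..} (- norm x) \<partial>lborel)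
    = \<sigma> * (\<integral>\<^sup>+(x::'a). indicator {s<..} (- norm x) \<partial>lborel)" for s
  proof (cases "s < 0")
    case False
    then have "indicator {s<..} (- norm x) = (0::ennreal)" for x :: 'a
      using norm_ge_zero[of x] by (auto simp: indicator_def simp del: norm_ge_zero)
    then show ?thesis by simp
  next
    case True
    define r where "r = - s"
    have r: "r > 0" using True by (simp add: r_def)
    have ind: "indicator {s<..} (- norm (r *\<^sub>R x)) = (indicator ?B x :: ennreal)" for x :: 'a
      using r by (auto simp: indicator_def r_def field_simps)
    have dir: "(r *\<^sub>R x) /\<^sub>R norm (r *\<^sub>R x) = x /\<^sub>R norm x" for x :: 'a
      using r by (simp add: divide_simps)
    have "(\<integral>\<^sup>+x. f (x /\<^sub>R norm x) * indicator {s<..} (- norm x) \<partial>lborel)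
      = ennreal (r ^ DIM('a)) * (\<sigma> * emeasure lborel ?B)"
      by (subst nn_integral_lborel_scale[OF _ r]) (simp_all only: dir ind \<sigma>, measurable)
    moreover have "(\<integral>\<^sup>+(x::'a). indicator {s<..} (- norm x) \<partial>lborel)
      = ennreal (r ^ DIM('a)) * emeasure lborel ?B"
      by (subst nn_integral_lborel_scale[OF _ r]) (simp_all only: ind, auto)
    ultimately show ?thesis by (simp add: ac_simps)
  qed
  have \<sigma>1: "\<sigma> \<le> 1"
  proof -
    interpret prob_space "uniform_sphere :: 'a measure" by (rule prob_space_uniform_sphere)
    have "\<sigma> \<le> (\<integral>\<^sup>+u. 1 \<partial>(uniform_sphere :: 'a measure))"
      unfolding \<sigma>_def by (intro nn_integral_mono f1)
    then show ?thesis using emeasure_space_1 by simp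
  qed
  have "distr (density lborel (\<lambda>x. f (x /\<^sub>R norm x))) borel (\<lambda>x::'a. - norm x)
    = density (distr lborel borel (\<lambda>x::'a. - norm x)) (\<lambda>_. \<sigma>)" (is "?L = ?R")
  proof (rule measure_eqI_lessThan)
    fix s :: real
    have 1: "emeasure ?L {s<..} = (\<integral>\<^sup>+x. f (x /\<^sub>R norm x) * indicator {s<..} (- norm x) \<partial>lborel)"
    proof -
      have "emeasure ?L {s<..} = (\<integral>\<^sup>+y. indicator {s<..} y \<partial>?L)" by simp
      then show ?thesis by (subst (asm) nn_integral_distr) (auto simp: nn_integral_density)
    qed
    have 2: "emeasure ?R {s<..} = \<sigma> * (\<integral>\<^sup>+(x::'a). indicator {s<..} (- norm x) \<partial>lborel)"
    proof -
      have "emeasure ?R {s<..} = (\<integral>\<^sup>+y. indicator {s<..} y \<partial>?R)" by simp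
      then show ?thesis
        by (subst (asm) nn_integral_density)
           (auto simp: nn_integral_distr nn_integral_cmult simp del: nn_integral_indicator)
    qed
    show "emeasure ?L {s<..} = emeasure ?R {s<..}"
      unfolding 1 2 by (rule ball)
    have "(\<integral>\<^sup>+(x::'a). indicator {s<..} (- norm x) \<partial>lborel) \<le> (\<integral>\<^sup>+(x::'a). indicator (ball 0 \<bar>s\<bar>) x \<partial>lborel)"
      by (intro nn_integral_mono) (auto simp: indicator_def)
    also have "\<dots> < \<infinity>"
      using emeasure_lborel_ball_finite[of "0::'a" "\<bar>s\<bar>"] by simp
    finally have "\<sigma> * (\<integral>\<^sup>+(x::'a). indicator {s<..} (- norm x) \<partial>lborel) < \<infinity>"
      using \<sigma>1 by (auto simp: ennreal_mult_less_top less_top[symmetric] ennreal_mult_eq_top_iff top_unique)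
    then show "emeasure ?L {s<..} < \<infinity>"
      unfolding 1 ball .
  qed auto
  then have "(\<integral>\<^sup>+s. q (- s) \<partial>?L) = (\<integral>\<^sup>+s. q (- s) \<partial>?R)" by simp
  then show ?thesis
    by (simp add: nn_integral_distr nn_integral_density nn_integral_cmult \<sigma>_def)
qed

lemma gauss_nn_integral_polar:
  fixes f :: "'a::euclidean_space \<Rightarrow> ennreal" and q :: "real \<Rightarrow> ennreal"
  assumes [measurable]: "f \<in> borel_measurable borel" "q \<in> borel_measurable borel"
    and f1: "\<And>x. f x \<le> 1"
  shows "(\<integral>\<^sup>+x. f (x /\<^sub>R norm x) * q (norm x) \<partial>gauss)
    = (\<integral>\<^sup>+u. f u \<partial>uniform_sphere) * (\<integral>\<^sup>+(x::'a). q (norm x) \<partial>gauss)"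
proof -
  define w where "w r = ennreal (exp (- r\<^sup>2 / 2) / sqrt (2 * pi) ^ DIM('a))" for r :: real
  have [measurable]: "w \<in> borel_measurable borel" unfolding w_def by measurable
  have w: "ennreal (gauss_density x) = w (norm x)" for x :: 'a
    by (simp add: w_def gauss_density_norm)
  show ?thesis
    using nn_integral_polar[of f "\<lambda>r. w r * q r"] f1
    by (simp add: gauss_def nn_integral_density w ac_simps)
qed

text \<open>
  With \<open>J k \<alpha>\<close> the integral of \<open>norm x ^ (2 * k) * exp (- \<alpha> * (norm x)\<^sup>2 / 2)\<close>, integrating
  \<open>J (Suc k) \<alpha> / 2\<close> over \<open>\<alpha> \<ge> 1\<close> gives \<open>J k 1\<close>, while scaling \<open>x\<close> gives
  \<open>J (Suc k) \<alpha>\<close> as a power of \<open>\<alpha>\<close> times \<open>J (Suc k) 1\<close>. Comparing the two yields the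
  recursion.
\<close>

lemma gauss_norm_power_Suc:
  "(\<integral>\<^sup>+(x::'a::euclidean_space). ennreal (norm x ^ (2 * Suc k)) \<partial>gauss)
    = ennreal (DIM('a) + 2 * k) * (\<integral>\<^sup>+(x::'a). ennreal (norm x ^ (2 * k)) \<partial>gauss)"
proof -
  let ?n = "DIM('a)"
  define J where "J k \<alpha> = (\<integral>\<^sup>+(x::'a). ennreal (norm x ^ (2 * k) * exp (- \<alpha> * (norm x)\<^sup>2 / 2)) \<partial>lborel)" for k \<alpha>
  have G: "(\<integral>\<^sup>+(x::'a). ennreal (norm x ^ (2 * k)) \<partial>gauss) = ennreal (1 / sqrt (2 * pi) ^ ?n) * J k 1" for k
    unfolding gauss_def J_def
    by (simp add: nn_integral_density nn_integral_cmult[symmetric] gauss_density_norm ac_simps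
        flip: ennreal_mult)
  have scal: "J k \<alpha> = ennreal (\<alpha> powr (- real k - ?n / 2)) * J k 1" if \<alpha>: "\<alpha> > 0" for k \<alpha>
  proof -
    define c where "c = 1 / sqrt \<alpha>"
    have c: "c > 0" "c\<^sup>2 * \<alpha> = 1" using \<alpha> by (auto simp: c_def power_divide)
    have "J k \<alpha> = ennreal (c ^ ?n) * (\<integral>\<^sup>+(x::'a). ennreal (norm (c *\<^sub>R x) ^ (2 * k) * exp (- \<alpha> * (norm (c *\<^sub>R x))\<^sup>2 / 2)) \<partial>lborel)"
      unfolding J_def by (rule nn_integral_lborel_scale) (use c in auto)
    also have "(\<lambda>x::'a. ennreal (norm (c *\<^sub>R x) ^ (2 * k) * exp (- \<alpha> * (norm (c *\<^sub>R x))\<^sup>2 / 2)))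
      = (\<lambda>x. ennreal (c ^ (2 * k)) * ennreal (norm x ^ (2 * k) * exp (- 1 * (norm x)\<^sup>2 / 2)))"
      using c by (auto simp: fun_eq_iff ennreal_mult'[symmetric] power_mult_distrib ac_simps)
    also have "ennreal (c ^ ?n) * (\<integral>\<^sup>+(x::'a). ennreal (c ^ (2 * k)) * ennreal (norm x ^ (2 * k) * exp (- 1 * (norm x)\<^sup>2 / 2)) \<partial>lborel)
      = ennreal (c ^ ?n * c ^ (2 * k)) * J k 1"
      using c unfolding J_def by (simp add: nn_integral_cmult ennreal_mult' mult.assoc)
    also have "c ^ ?n * c ^ (2 * k) = \<alpha> powr (- real k - ?n / 2)"
    proof -
      have "c = \<alpha> powr (- 1 / 2)"
        using \<alpha> by (simp add: c_def powr_half_sqrt[symmetric] powr_minus_divide)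
      then have "c powr (real ?n + 2 * real k) = \<alpha> powr (- 1 / 2 * (real ?n + 2 * real k))"
        by (simp only: powr_powr)
      moreover have "- 1 / 2 * (real ?n + 2 * real k) = - real k - ?n / 2"
        by (simp add: field_simps)
      moreover have "c ^ ?n * c ^ (2 * k) = c powr (real ?n + 2 * real k)"
        using powr_realpow[OF c(1), of "?n + 2 * k"] by (simp add: power_add)
      ultimately show ?thesis by (simp only:)
    qed
    finally show ?thesis .
  qed
  have gauss_split: "ennreal (norm x ^ (2 * k) * exp (- 1 * (norm x)\<^sup>2 / 2))
    = (\<integral>\<^sup>+\<alpha>. ennreal (norm x ^ (2 * Suc k) * exp (- \<alpha> * (norm x)\<^sup>2 / 2) / 2) * indicator {1..} \<alpha> \<partial>lborel)"
    if "x \<noteq> 0" for x :: 'a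
  proof -
    have "((\<lambda>\<alpha>. - (norm x ^ (2 * k)) * exp (- \<alpha> * (norm x)\<^sup>2 / 2)) \<longlongrightarrow> - (norm x ^ (2 * k)) * 0) at_top"
      using that by (intro tendsto_intros filterlim_compose[OF exp_at_bot]) real_asymp
    then have "(\<integral>\<^sup>+\<alpha>. ennreal (norm x ^ (2 * Suc k) * exp (- \<alpha> * (norm x)\<^sup>2 / 2) / 2) * indicator {1..} \<alpha> \<partial>lborel)
      = ennreal (0 - (- (norm x ^ (2 * k)) * exp (- 1 * (norm x)\<^sup>2 / 2)))"
      by (intro nn_integral_FTC_atLeast)
         (auto intro!: derivative_eq_intros simp: power2_eq_square power_mult)
    then show ?thesis by simp
  qed
  have "J k 1 = (\<integral>\<^sup>+(x::'a). (\<integral>\<^sup>+\<alpha>. ennreal (norm x ^ (2 * Suc k) * exp (- \<alpha> * (norm x)\<^sup>2 / 2) / 2) * indicator {1..} \<alpha> \<partial>lborel) \<partial>lborel)"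
    unfolding J_def
    using AE_lborel_singleton[of "0::'a"]
    by (intro nn_integral_cong_AE, elim eventually_mono) (rule gauss_split)
  also have "\<dots> = (\<integral>\<^sup>+\<alpha>. (\<integral>\<^sup>+(x::'a). ennreal (norm x ^ (2 * Suc k) * exp (- \<alpha> * (norm x)\<^sup>2 / 2) / 2) * indicator {1..} \<alpha> \<partial>lborel) \<partial>lborel)"
    by (rule lborel_pair.Fubini') measurable
  also have "\<dots> = (\<integral>\<^sup>+\<alpha>. (ennreal (\<alpha> powr (- real (Suc k) - ?n / 2) / 2) * indicator {1..} \<alpha>) * J (Suc k) 1 \<partial>lborel)"
  proof (rule nn_integral_cong)
    fix \<alpha> :: real
    have "(\<integral>\<^sup>+(x::'a). ennreal (norm x ^ (2 * Suc k) * exp (- \<alpha> * (norm x)\<^sup>2 / 2) / 2) * indicator {1..} \<alpha> \<partial>lborel)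
      = (ennreal (1 / 2) * J (Suc k) \<alpha>) * indicator {1..} \<alpha>"
    proof -
      have "ennreal (z / 2) = ennreal (1 / 2) * ennreal z" if "z \<ge> 0" for z
        using that by (subst ennreal_mult[symmetric]) simp_all
      then show ?thesis
        unfolding J_def by (simp add: nn_integral_multc nn_integral_cmult del: power_Suc)
    qed
    also have "\<dots> = (ennreal (\<alpha> powr (- real (Suc k) - ?n / 2) / 2) * indicator {1..} \<alpha>) * J (Suc k) 1"
    proof (cases "\<alpha> \<ge> 1")
      case True
      have "ennreal (1 / 2) * ennreal z = ennreal (z / 2)" if "z \<ge> 0" for z
        using that by (subst ennreal_mult[symmetric]) simp_all
      then show ?thesis
        using True by (subst scal) (auto simp: mult.assoc[symmetric] simp del: of_nat_Suc)
    qed simp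
    finally show "(\<integral>\<^sup>+(x::'a). ennreal (norm x ^ (2 * Suc k) * exp (- \<alpha> * (norm x)\<^sup>2 / 2) / 2) * indicator {1..} \<alpha> \<partial>lborel)
      = (ennreal (\<alpha> powr (- real (Suc k) - ?n / 2) / 2) * indicator {1..} \<alpha>) * J (Suc k) 1" .
  qed
  also have "\<dots> = (\<integral>\<^sup>+\<alpha>. ennreal (\<alpha> powr (- real (Suc k) - ?n / 2) / 2) * indicator {1..} \<alpha> \<partial>lborel) * J (Suc k) 1"
    by (rule nn_integral_multc) measurable
  also have "(\<integral>\<^sup>+\<alpha>. ennreal (\<alpha> powr (- real (Suc k) - ?n / 2) / 2) * indicator {1..} \<alpha> \<partial>lborel)
    = ennreal (1 / (?n + 2 * k))"
  proof -
    define e where "e = real k + ?n / 2"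
    have e: "e > 0" by (simp add: e_def add_nonneg_pos)
    have "((\<lambda>\<alpha>::real. - (\<alpha> powr (- e)) / (2 * e)) \<longlongrightarrow> - 0 / (2 * e)) at_top"
      using e by (intro tendsto_intros tendsto_neg_powr filterlim_ident) auto
    then have "(\<integral>\<^sup>+\<alpha>. ennreal (\<alpha> powr (- e - 1) / 2) * indicator {1..} \<alpha> \<partial>lborel)
      = ennreal (- 0 / (2 * e) - (- (1 powr (- e)) / (2 * e)))"
      using e by (intro nn_integral_FTC_atLeast) (auto intro!: derivative_eq_intros)
    also have "- 0 / (2 * e) - (- (1 powr (- e)) / (2 * e)) = 1 / (?n + 2 * k)"
      by (simp add: e_def algebra_simps)
    also have "- e - 1 = - real (Suc k) - ?n / 2" by (simp add: e_def)
    finally show ?thesis .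
  qed
  finally have J: "J k 1 = ennreal (1 / (?n + 2 * k)) * J (Suc k) 1" .
  have "ennreal (real ?n + 2 * k) * J k 1 = J (Suc k) 1"
  proof -
    have "real ?n + 2 * k > 0" by (simp add: add_pos_nonneg)
    then have "ennreal (real ?n + 2 * k) * ennreal (1 / (?n + 2 * k)) = 1"
      by (subst ennreal_mult[symmetric]) auto
    then show ?thesis unfolding J by (simp only: mult.assoc[symmetric] mult_1)
  qed
  then show ?thesis
    unfolding G by (simp add: mult.left_commute)
qed

lemma gauss_norm_power:
  "(\<integral>\<^sup>+(x::'a::euclidean_space). ennreal (norm x ^ (2 * k)) \<partial>gauss)
    = ennreal (2 ^ k * pochhammer (DIM('a) / 2) k)"
proof (induction k)
  case 0
  show ?case using prob_space.emeasure_space_1[OF prob_space_gauss[where 'a='a]] by simp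
next
  case (Suc k)
  then show ?case
    unfolding gauss_norm_power_Suc
    by (subst Suc, subst ennreal_mult[symmetric])
       (auto simp: pochhammer_Suc algebra_simps intro!: less_imp_le[OF pochhammer_pos] mult_nonneg_nonneg arg_cong[where f=ennreal])
qed

section \<open>The orthogonality shadow is null\<close>

lemma distr_gauss_inner:
  assumes "norm a = 1"
  shows "distr gauss borel (\<lambda>x. x \<bullet> a) = std_normal_distribution"
proof (rule Levy_uniqueness)
  interpret prob_space "gauss :: 'a measure" by (rule prob_space_gauss)
  show "real_distribution (distr gauss borel (\<lambda>x. x \<bullet> a))"
    by (rule real_distribution_distr) measurable
  show "real_distribution std_normal_distribution"
    by (rule real_dist_normal_dist)
  show "char (distr gauss borel (\<lambda>x. x \<bullet> a)) = char std_normal_distribution"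
  proof
    fix t
    have "char (distr gauss borel (\<lambda>x. x \<bullet> a)) t = (\<integral>x. iexp (x \<bullet> (t *\<^sub>R a)) \<partial>gauss)"
      unfolding char_def by (subst integral_distr) auto
    then show "char (distr gauss borel (\<lambda>x. x \<bullet> a)) t = char std_normal_distribution t"
      unfolding gauss_integral_iexp using assms
      by (simp add: char_std_normal_distribution flip: of_real_exp)
  qed
qed

lemma gauss_slab_le:
  assumes "norm a = 1" and s: "s \<ge> 0"
  shows "emeasure gauss {x. \<bar>x \<bullet> a\<bar> \<le> s} \<le> ennreal s"
proof -
  have "std_normal_density x \<le> 1 / 2" for x
  proof -
    have "2 \<le> sqrt (2 * pi)"
      using pi_ge_two by (intro real_le_rsqrt) auto
    moreover have "exp (- x\<^sup>2 / 2) \<le> 1" by simp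
    ultimately show ?thesis
      unfolding std_normal_density_def
      using mult_mono[of "1 / sqrt (2 * pi)" "1 / 2" "exp (- x\<^sup>2 / 2)" 1]
        divide_left_mono[of 2 "sqrt (2 * pi)" 1] by simp
  qed
  then have le: "ennreal (std_normal_density x) * indicator {- s..s} x \<le> ennreal (1 / 2) * indicator {- s..s} x" for x
    by (intro mult_right_mono ennreal_leI) auto
  have "emeasure gauss {x. \<bar>x \<bullet> a\<bar> \<le> s} = emeasure (distr gauss borel (\<lambda>x. x \<bullet> a)) {- s..s}"
    by (subst emeasure_distr) (auto intro!: arg_cong[where f="emeasure gauss"] simp: abs_le_iff)
  also have "\<dots> = (\<integral>\<^sup>+x. ennreal (std_normal_density x) * indicator {- s..s} x \<partial>lborel)"
    unfolding distr_gauss_inner[OF assms(1)] by (subst emeasure_density) auto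
  also have "\<dots> \<le> (\<integral>\<^sup>+x. ennreal (1 / 2) * indicator {- s..s} x \<partial>lborel)"
    by (intro nn_integral_mono le)
  also have "\<dots> = ennreal (1 / 2) * ennreal (s - (- s))"
    using s by (subst nn_integral_cmult_indicator) auto
  also have "\<dots> = ennreal s"
    using s by (subst ennreal_mult[symmetric]) auto
  finally show ?thesis .
qed

text \<open>
  The Gaussian density is positive everywhere, so slabs can be measured with \<^const>\<open>gauss\<close>, where
  the bound does not depend on the direction or the dimension, instead of Lebesgue measure.
\<close>

lemma null_sets_gauss: "null_sets (gauss :: 'a::euclidean_space measure) = null_sets lborel"
proof -
  have "A \<in> null_sets gauss \<longleftrightarrow> A \<in> null_sets lborel" for A :: "'a set"
  proof -
    have "ennreal (gauss_density x) \<noteq> 0" for x :: 'a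
      using gauss_density_pos[of x] by simp
    then have "A \<in> null_sets gauss \<longleftrightarrow> A \<in> sets lborel \<and> (AE x in lborel. x \<notin> A)"
      unfolding gauss_def by (subst null_sets_density_iff) auto
    then show ?thesis
      using AE_iff_null_sets[of A lborel] by (metis null_setsD2)
  qed
  then show ?thesis by blast
qed

lemma hausdorff1_zero_cover:
  assumes "hausdorff1 K = 0" and "e > 0"
  obtains C :: "nat \<Rightarrow> 'a::metric_space set" where "K \<subseteq> (\<Union>i. C i)" "\<And>i. bounded (C i)"
    "(\<Sum>i. ennreal (diameter (C i))) < e"
proof -
  have "hausdorff1_pre 1 K \<le> hausdorff1 K"
    unfolding hausdorff1_def by (intro SUP_upper) auto
  with assms have "hausdorff1_pre 1 K < e" by simp
  then show thesis
    unfolding hausdorff1_pre_def Inf_less_iff using that by auto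
qed

definition orthogonal_directions :: "'a::euclidean_space set \<Rightarrow> 'a set" where
  "orthogonal_directions K = {x. \<exists>a\<in>K. a \<bullet> x = 0}"

text \<open>
  Compactness of \<open>K\<close> turns the infimum defining \<^const>\<open>Omega\<close> into a uniform lower bound, which is
  the form in which membership is used below.
\<close>

lemma Omega_bound:
  assumes "compact K" "K \<noteq> {}"
  shows "x \<in> Omega K \<longleftrightarrow> (\<exists>c>0. \<forall>a\<in>K. c \<le> \<bar>a \<bullet> x\<bar>)"
proof
  assume "x \<in> Omega K"
  then have "(INF a\<in>K. \<bar>a \<bullet> x\<bar>) > 0" by (simp add: Omega_def)
  moreover have "(INF a\<in>K. \<bar>a \<bullet> x\<bar>) \<le> \<bar>a \<bullet> x\<bar>" if "a \<in> K" for a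
    using that by (intro cINF_lower bdd_belowI[of _ 0]) auto
  ultimately show "\<exists>c>0. \<forall>a\<in>K. c \<le> \<bar>a \<bullet> x\<bar>" by blast
next
  assume "\<exists>c>0. \<forall>a\<in>K. c \<le> \<bar>a \<bullet> x\<bar>"
  then obtain c where c: "c > 0" "\<And>a. a \<in> K \<Longrightarrow> c \<le> \<bar>a \<bullet> x\<bar>" by blast
  have "c \<le> (INF a\<in>K. \<bar>a \<bullet> x\<bar>)"
    using assms c by (intro cINF_greatest) auto
  with c(1) show "x \<in> Omega K" by (simp add: Omega_def)
qed

lemma Omega_eq:
  assumes "compact K" "K \<noteq> {}"
  shows "Omega K = - orthogonal_directions K"
proof (intro set_eqI iffI)
  fix x assume "x \<in> Omega K"
  then show "x \<in> - orthogonal_directions K"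
    unfolding Omega_bound[OF assms] orthogonal_directions_def by force
next
  fix x assume x: "x \<in> - orthogonal_directions K"
  have "continuous_on K (\<lambda>a. \<bar>a \<bullet> x\<bar>)" by (intro continuous_intros)
  then obtain a where a: "a \<in> K" "\<And>b. b \<in> K \<Longrightarrow> \<bar>a \<bullet> x\<bar> \<le> \<bar>b \<bullet> x\<bar>"
    using continuous_attains_inf[OF assms] by blast
  moreover have "\<bar>a \<bullet> x\<bar> > 0" using x a(1) by (auto simp: orthogonal_directions_def)
  ultimately show "x \<in> Omega K" unfolding Omega_bound[OF assms] by blast
qed

lemma Omega_ball:
  assumes "compact K" "K \<noteq> {}" "K \<subseteq> sphere 0 1" "x \<in> Omega K"
  obtains c where "c > 0" "\<And>y a. y \<in> ball x c \<Longrightarrow> a \<in> K \<Longrightarrow> c \<le> \<bar>a \<bullet> y\<bar>"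
proof -
  obtain c where c: "c > 0" "\<And>a. a \<in> K \<Longrightarrow> c \<le> \<bar>a \<bullet> x\<bar>"
    using assms by (auto simp: Omega_bound)
  show thesis
  proof (rule that[of "c / 2"])
    fix y a assume y: "y \<in> ball x (c / 2)" and a: "a \<in> K"
    have "\<bar>a \<bullet> (x - y)\<bar> \<le> norm a * norm (x - y)" by (rule Cauchy_Schwarz_ineq2)
    also have "\<dots> \<le> c / 2" using a assms(3) y by (auto simp: dist_norm)
    finally have "\<bar>a \<bullet> (x - y)\<bar> \<le> c / 2" .
    moreover have "\<bar>a \<bullet> x\<bar> - \<bar>a \<bullet> y\<bar> \<le> \<bar>a \<bullet> (x - y)\<bar>"
      unfolding inner_diff_right by (rule abs_triangle_ineq2)
    ultimately show "c / 2 \<le> \<bar>a \<bullet> y\<bar>" using c(2)[OF a] by linarith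
  qed (use c in simp)
qed

lemma open_Omega:
  assumes "compact K" "K \<noteq> {}" "K \<subseteq> sphere 0 1"
  shows "open (Omega K)"
proof (rule openI)
  fix x assume "x \<in> Omega K"
  then obtain c where c: "c > 0" "\<And>y a. y \<in> ball x c \<Longrightarrow> a \<in> K \<Longrightarrow> c \<le> \<bar>a \<bullet> y\<bar>"
    using Omega_ball[OF assms] by blast
  then have "ball x c \<subseteq> Omega K" unfolding Omega_bound[OF assms(1,2)] subset_iff by blast
  with c(1) show "\<exists>e>0. ball x e \<subseteq> Omega K" by blast
qed

text \<open>
  If \<open>b \<in> C i\<close> is orthogonal to \<open>x\<close>, then any other point \<open>center i\<close> of \<open>C i\<close> is
  orthogonal to \<open>x\<close> up to \<open>diameter (C i) * norm x\<close>. So the slabs \<open>T i\<close> cover the bounded part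
  of the set, and their total measure is controlled by the sum of the diameters.
\<close>

lemma orthogonal_directions_null:
  fixes K :: "'a::euclidean_space set"
  assumes "compact K" "K \<noteq> {}" "K \<subseteq> sphere 0 1" and "hausdorff1 K = 0"
  shows "orthogonal_directions K \<in> null_sets lborel"
proof -
  let ?N = "orthogonal_directions K"
  have "closed ?N"
    using open_Omega[OF assms(1-3)] by (simp add: Omega_eq assms closed_def)
  then have N [measurable]: "?N \<in> sets borel" by (rule borel_closed)
  have "?N \<inter> cball 0 (real n) \<in> null_sets gauss" for n
  proof -
    have "emeasure gauss (?N \<inter> cball 0 (real n)) \<le> 0 + ennreal e" if e: "e > 0" for e
    proof -
      \<comment> \<open>The factor \<open>real n + 1\<close> bounds \<open>norm x\<close> and, unlike \<open>real n\<close>, is never 0.\<close>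
      have "ennreal (e / (real n + 1)) > 0" using e by simp
      from hausdorff1_zero_cover[OF assms(4) this] obtain C :: "nat \<Rightarrow> 'a set"
        where C: "K \<subseteq> (\<Union>i. C i)" "\<And>i. bounded (C i)"
          "(\<Sum>i. ennreal (diameter (C i))) < ennreal (e / (real n + 1))" by blast
      define center where "center i = (SOME a. a \<in> C i \<inter> K)" for i
      have center: "center i \<in> C i \<inter> K" if "C i \<inter> K \<noteq> {}" for i
        using that some_in_eq[of "C i \<inter> K"] by (simp only: center_def not_False_eq_True)
      define T where "T i = {x. C i \<inter> K \<noteq> {} \<and> \<bar>x \<bullet> center i\<bar> \<le> diameter (C i) * (real n + 1)}" for i
      have [measurable]: "T i \<in> sets borel" for i unfolding T_def by measurable
      have T: "emeasure gauss (T i) \<le> ennreal (diameter (C i)) * ennreal (real n + 1)" for i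
      proof (cases "C i \<inter> K = {}")
        case False
        then have "norm (center i) = 1" using assms(3) center[of i] by (auto simp: subset_iff)
        from gauss_slab_le[OF this, of "diameter (C i) * (real n + 1)"]
        have "emeasure gauss (T i) \<le> ennreal (diameter (C i) * (real n + 1))"
          using False diameter_ge_0[OF C(2)[of i]] by (simp add: T_def)
        then show ?thesis
          using diameter_ge_0[OF C(2)[of i]] by (subst ennreal_mult[symmetric]) auto
      qed (simp add: T_def)
      have "?N \<inter> cball 0 (real n) \<subseteq> (\<Union>i. T i)"
      proof
        fix x assume "x \<in> ?N \<inter> cball 0 (real n)"
        then obtain b where b: "b \<in> K" "b \<bullet> x = 0" and x: "norm x \<le> real n"
          by (auto simp: orthogonal_directions_def)
        then obtain i where i: "b \<in> C i" using C(1) by auto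
        define a where "a = center i"
        have a: "a \<in> C i \<inter> K" unfolding a_def by (rule center) (use b i in auto)
        have "\<bar>x \<bullet> a\<bar> = \<bar>(a - b) \<bullet> x\<bar>" using b(2) by (simp add: inner_diff_left inner_commute[of x a])
        also have "\<dots> \<le> norm (a - b) * norm x" by (rule Cauchy_Schwarz_ineq2)
        also have "\<dots> \<le> diameter (C i) * (real n + 1)"
          using diameter_bounded_bound[OF C(2)[of i], of a b] a i x diameter_ge_0[OF C(2)[of i]]
          by (intro mult_mono) (auto simp: dist_norm)
        finally show "x \<in> (\<Union>i. T i)" using a by (auto simp: T_def a_def)
      qed
      then have "emeasure gauss (?N \<inter> cball 0 (real n)) \<le> emeasure gauss (\<Union>i. T i)"
        by (intro emeasure_mono) auto
      also have "\<dots> \<le> (\<Sum>i. emeasure gauss (T i))"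
        by (intro emeasure_subadditive_countably) auto
      also have "\<dots> \<le> (\<Sum>i. ennreal (diameter (C i)) * ennreal (real n + 1))"
        by (intro suminf_le T) auto
      also have "\<dots> = (\<Sum>i. ennreal (diameter (C i))) * ennreal (real n + 1)"
        by (rule ennreal_suminf_multc)
      also have "\<dots> \<le> ennreal (e / (real n + 1)) * ennreal (real n + 1)"
        by (intro mult_right_mono less_imp_le[OF C(3)]) auto
      also have "\<dots> = ennreal e"
        using e by (subst ennreal_mult[symmetric]) auto
      finally show ?thesis by simp
    qed
    then have "emeasure gauss (?N \<inter> cball 0 (real n)) \<le> 0"
      by (rule ennreal_le_epsilon)
    then show ?thesis by auto
  qed
  then have "(\<Union>n. ?N \<inter> cball 0 (real n)) \<in> null_sets gauss"
    by (rule null_sets_UN)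
  moreover have "(\<Union>n. ?N \<inter> cball 0 (real n)) = ?N"
  proof -
    have "\<exists>n. norm x \<le> real n" for x :: 'a by (rule real_arch_simple)
    then show ?thesis by auto
  qed
  ultimately show ?thesis by (simp add: null_sets_gauss)
qed

lemma AE_uniform_sphereI:
  assumes "AE x in lborel. P (x /\<^sub>R norm (x::'a::euclidean_space))" "Measurable.pred borel P"
  shows "AE u in (uniform_sphere :: 'a measure). P u"
  unfolding uniform_sphere_def using assms
  by (subst AE_distr_iff) (auto intro!: AE_uniform_measureI)

lemma AE_Omega:
  fixes K :: "'a::euclidean_space set"
  assumes "compact K" "K \<noteq> {}" "K \<subseteq> sphere 0 1" and "hausdorff1 K = 0"
  shows "AE x in lborel. x \<in> Omega K"
    and "AE x in gauss. x \<in> Omega K"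
    and "AE u in uniform_sphere. u \<in> Omega K"
proof -
  show 1: "AE x in lborel. x \<in> Omega K"
    using orthogonal_directions_null[OF assms] by (rule AE_I') (auto simp: Omega_eq assms)
  show "AE x in gauss. x \<in> Omega K"
    using orthogonal_directions_null[OF assms] unfolding null_sets_gauss[symmetric] 
    by (rule AE_I') (auto simp: Omega_eq assms)
  have [measurable]: "Omega K \<in> sets borel"
    using open_Omega[OF assms(1-3)] by simp
  show "AE u in uniform_sphere. u \<in> Omega K"
  proof (rule AE_uniform_sphereI)
    show "AE x in lborel. x /\<^sub>R norm x \<in> Omega K"
      using 1 AE_lborel_singleton[of "0::'a"]
      by eventually_elim (auto simp: Omega_eq assms orthogonal_directions_def)
  qed measurable
qed

lemma orthogonality_shadow_null:
  assumes "compact K" "K \<noteq> {}" "K \<subseteq> sphere 0 1" and "hausdorff1 K = 0"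
  shows "orthogonality_shadow K \<in> null_sets uniform_sphere"
proof -
  have eq: "orthogonality_shadow K = sphere 0 1 - Omega K"
    using assms by (auto simp: Omega_eq orthogonality_shadow_def orthogonal_directions_def)
  have "orthogonality_shadow K \<in> sets borel"
    unfolding eq using open_Omega[OF assms(1-3)] by (intro sets.Diff borel_closed borel_open) auto
  moreover have "AE u in uniform_sphere. u \<notin> orthogonality_shadow K"
    using AE_Omega(3)[OF assms] unfolding eq by eventually_elim simp
  ultimately show ?thesis by (simp add: AE_iff_null_sets)
qed

section \<open>Differentiation under the integral sign\<close>

text \<open>
  A locally bounded derivative makes \<open>f\<close> locally Lipschitz in \<open>x\<close> uniformly in \<open>a\<close>, so the
  difference quotients are dominated by a constant, which is integrable for a finite measure. The lemma serves
  twice: with complex \<open>x\<close> it shows that averages of holomorphic functions are holomorphic, and with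
  \<open>x\<close> in a Euclidean space it differentiates the logarithmic potential.
\<close>

lemma has_derivative_integral_dominated:
  fixes f :: "'x::real_normed_vector \<Rightarrow> 'a \<Rightarrow> 'b::{banach, second_countable_topology}"
  assumes "finite_measure M" and r: "r > 0" and C: "C \<ge> 0"
    and int: "\<And>x. x \<in> ball x0 r \<Longrightarrow> integrable M (f x)"
    and S: "AE a in M. a \<in> S"
    and der: "\<And>x a. x \<in> ball x0 r \<Longrightarrow> a \<in> S \<Longrightarrow> ((\<lambda>x. f x a) has_derivative f' x a) (at x)"
    and bound: "\<And>x a v. x \<in> ball x0 r \<Longrightarrow> a \<in> S \<Longrightarrow> norm (f' x a v) \<le> C * norm v"
    and meas [measurable]: "\<And>v. (\<lambda>a. f' x0 a v) \<in> borel_measurable M"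
  shows "((\<lambda>x. \<integral>a. f x a \<partial>M) has_derivative (\<lambda>v. \<integral>a. f' x0 a v \<partial>M)) (at x0)"
proof -
  interpret finite_measure M by fact
  have x0: "x0 \<in> ball x0 r" using r by simp
  have int': "integrable M (\<lambda>a. f' x0 a v)" for v
    by (rule integrable_const_bound[where B="C * norm v"])
      (use S in \<open>auto intro: bound[OF x0] elim!: eventually_mono\<close>)
  have lin: "bounded_linear (f' x0 a)" if "a \<in> S" for a
    using der[OF x0 that] by (rule has_derivative_bounded_linear)
  have blin: "bounded_linear (\<lambda>v. \<integral>a. f' x0 a v \<partial>M)"
  proof (rule bounded_linear_intro)
    fix v w
    have "(\<integral>a. f' x0 a (v + w) \<partial>M) = (\<integral>a. f' x0 a v + f' x0 a w \<partial>M)"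
      by (rule integral_cong_AE)
        (use S in \<open>auto simp: linear_add[OF bounded_linear.linear[OF lin]] elim!: eventually_mono\<close>)
    then show "(\<integral>a. f' x0 a (v + w) \<partial>M) = (\<integral>a. f' x0 a v \<partial>M) + (\<integral>a. f' x0 a w \<partial>M)"
      by (simp add: int')
  next
    fix c v
    have "(\<integral>a. f' x0 a (c *\<^sub>R v) \<partial>M) = (\<integral>a. c *\<^sub>R f' x0 a v \<partial>M)"
      by (rule integral_cong_AE)
        (use S in \<open>auto simp: linear_scale[OF bounded_linear.linear[OF lin]] elim!: eventually_mono\<close>)
    then show "(\<integral>a. f' x0 a (c *\<^sub>R v) \<partial>M) = c *\<^sub>R (\<integral>a. f' x0 a v \<partial>M)" by simp
  next
    fix v
    have "norm (\<integral>a. f' x0 a v \<partial>M) \<le> (\<integral>a. norm (f' x0 a v) \<partial>M)"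
      by (rule integral_norm_bound)
    also have "\<dots> \<le> (\<integral>a. C * norm v \<partial>M)"
      by (rule integral_mono_AE)
        (use S int' in \<open>auto intro: bound[OF x0] elim!: eventually_mono\<close>)
    finally show "norm (\<integral>a. f' x0 a v \<partial>M) \<le> norm v * (C * measure M (space M))"
      by (simp add: ac_simps)
  qed
  have lip: "norm (f x a - f x0 a) \<le> C * norm (x - x0)" if "x \<in> ball x0 r" "a \<in> S" for x a
  proof (rule differentiable_bound[of "ball x0 r" "\<lambda>x. f x a" "\<lambda>x. f' x a"])
    fix y assume y: "y \<in> ball x0 r"
    show "((\<lambda>x. f x a) has_derivative f' y a) (at y within ball x0 r)"
      using der[OF y that(2)] by (rule has_derivative_at_withinI)
    show "onorm (f' y a) \<le> C"
      using bound[OF y that(2)] by (intro onorm_bound C)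
  qed (use that x0 in auto)
  define e where "e x a = (f x a - f x0 a - f' x0 a (x - x0)) /\<^sub>R norm (x - x0)" for x a
  have "((\<lambda>x. ((\<integral>a. f x a \<partial>M) - (\<integral>a. f x0 a \<partial>M) - (\<integral>a. f' x0 a (x - x0) \<partial>M)) /\<^sub>R norm (x - x0))
      \<longlongrightarrow> 0) (at x0)"
    unfolding tendsto_at_iff_sequentially
  proof (intro allI impI)
    fix X assume X: "\<forall>i. X i \<in> UNIV - {x0}" "X \<longlonglongrightarrow> x0"
    \<comment> \<open>Measurability of \<open>e (X n)\<close> is known only for \<open>X n\<close> in the ball.\<close>
    define s where "s n = (if X n \<in> ball x0 r then e (X n) else (\<lambda>_. 0))" for n
    have ev: "eventually (\<lambda>n. X n \<in> ball x0 r) sequentially"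
      using X(2) open_ball x0 by (rule topological_tendstoD)
    have es: "(\<integral>a. s n a \<partial>M) = ((\<integral>a. f (X n) a \<partial>M) - (\<integral>a. f x0 a \<partial>M) - (\<integral>a. f' x0 a (X n - x0) \<partial>M)) /\<^sub>R norm (X n - x0)"
      if "X n \<in> ball x0 r" for n
      using that by (simp add: s_def e_def int[OF x0] int int')
    have e_int: "integrable M (e x)" if "x \<in> ball x0 r" for x
      unfolding e_def using that by (intro integrable_scaleR_right Bochner_Integration.integrable_diff int int' x0)
    have "(\<lambda>n. \<integral>a. s n a \<partial>M) \<longlonglongrightarrow> (\<integral>a. 0 \<partial>M)"
    proof (rule integral_dominated_convergence[where w="\<lambda>_. 2 * C"])
      show "s n \<in> borel_measurable M" for n
        unfolding s_def using e_int[of "X n"] by auto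
      show "AE a in M. norm (s n a) \<le> 2 * C" for n
        using S
      proof eventually_elim
        case (elim a)
        show ?case
        proof (cases "X n \<in> ball x0 r")
          case True
          have nz: "norm (X n - x0) > 0" using X(1) by simp
          have "norm (f (X n) a - f x0 a - f' x0 a (X n - x0)) \<le> C * norm (X n - x0) + C * norm (X n - x0)"
            using lip[OF True elim] bound[OF x0 elim] by (rule norm_triangle_le_diff[OF add_mono])
          then show ?thesis
            using True nz by (simp add: s_def e_def divide_simps mult.commute)
        qed (simp add: s_def C)
      qed
      show "AE a in M. (\<lambda>n. s n a) \<longlonglongrightarrow> 0"
        using S
      proof eventually_elim
        case (elim a)
        have "((\<lambda>x. e x a) \<longlongrightarrow> 0) (at x0)"
          using der[OF x0 elim] unfolding has_derivative_at_within e_def by simp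
        then have "(\<lambda>n. e (X n) a) \<longlonglongrightarrow> 0"
          using X unfolding tendsto_at_iff_sequentially comp_def by blast
        then show ?case
          by (rule Lim_transform_eventually) (use ev in \<open>auto simp: s_def elim!: eventually_mono\<close>)
      qed
    qed auto
    then show "((\<lambda>x. ((\<integral>a. f x a \<partial>M) - (\<integral>a. f x0 a \<partial>M) - (\<integral>a. f' x0 a (x - x0) \<partial>M)) /\<^sub>R norm (x - x0)) \<circ> X) \<longlonglongrightarrow> 0"
      unfolding comp_def integral_zero
      by (rule Lim_transform_eventually) (use ev es in \<open>auto elim!: eventually_mono\<close>)
  qed
  then show ?thesis
    unfolding has_derivative_at_within using blin by simp
qed

section \<open>Averages of Cayley transforms\<close>

text \<open>
  A conformal map of the unit disc onto the upper half plane that sends 0 to \<open>\<i>\<close>. On the unit circle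
  \<open>cayley (cis (2 * \<theta>)) = tan \<theta>\<close>.
\<close>

definition cayley :: "complex \<Rightarrow> complex" where
  "cayley v = \<i> * (1 - v) / (1 + v)"

lemma Im_cayley_nonneg:
  assumes "norm v \<le> 1"
  shows "0 \<le> Im (cayley v)"
proof -
  have "cayley v = \<i> * ((1 - v) / (1 + v))" by (simp add: cayley_def)
  then have "Im (cayley v) = Re ((1 - v) / (1 + v))" by (simp only: Im_i_times)
  also have "\<dots> = (1 - (norm v)\<^sup>2) / (norm (1 + v))\<^sup>2"
    unfolding Re_divide' cmod_power2[of v] by (simp add: algebra_simps power2_eq_square)
  finally show ?thesis
    using assms power_le_one[of "norm v" 2] by simp
qed

lemma norm_cayley_le:
  assumes "norm v \<le> 1" "c > 0" "c \<le> norm (1 + v)"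
  shows "norm (cayley v) \<le> 2 / c"
proof -
  have "norm (1 - v) \<le> 2"
    using norm_triangle_ineq4[of 1 v] assms(1) by simp
  then show ?thesis
    unfolding cayley_def norm_divide norm_mult using assms by (simp add: frac_le)
qed

text \<open>
  Radial approach to a boundary point \<open>v\<close> stays away from the pole \<open>- 1\<close> as long as \<open>v\<close> does;
  this provides the dominating function for radial limits.
\<close>

lemma norm_one_plus_scaled:
  fixes v :: complex
  assumes "norm v = 1" "0 \<le> \<rho>" "\<rho> \<le> 1"
  shows "norm (1 + v) \<le> 2 * norm (1 + of_real \<rho> * v)"
proof -
  have "norm (of_real (1 - \<rho>) * v) = 1 - \<rho>"
    using assms by (simp add: norm_mult del: of_real_diff)
  moreover have "1 + v = (1 + of_real \<rho> * v) + of_real (1 - \<rho>) * v"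
    by (simp add: algebra_simps)
  ultimately have "norm (1 + v) \<le> norm (1 + of_real \<rho> * v) + (1 - \<rho>)"
    by (metis norm_triangle_ineq)
  moreover have "1 - \<rho> \<le> norm (1 + of_real \<rho> * v)"
    using norm_diff_ineq[of 1 "of_real \<rho> * v"] assms by (simp add: norm_mult)
  ultimately show ?thesis by simp
qed

locale unimodular_mixture = prob_space M for M :: "'a measure" +
  fixes \<kappa> :: "'a \<Rightarrow> complex"
  assumes \<kappa>_meas [measurable]: "\<kappa> \<in> borel_measurable M"
    and \<kappa>_norm: "AE a in M. norm (\<kappa> a) = 1"
begin

definition cayley_mean :: "complex \<Rightarrow> complex" where
  "cayley_mean w = (\<integral>a. cayley (w * \<kappa> a) \<partial>M)"

lemma cayley_integrable:
  assumes "norm w < 1"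
  shows "integrable M (\<lambda>a. cayley (w * \<kappa> a))"
proof (rule integrable_const_bound)
  show "AE a in M. norm (cayley (w * \<kappa> a)) \<le> 2 / (1 - norm w)"
    using \<kappa>_norm
  proof eventually_elim
    case (elim a)
    show ?case
      using assms elim norm_diff_ineq[of 1 "w * \<kappa> a"]
      by (intro norm_cayley_le) (auto simp: norm_mult)
  qed
  show "(\<lambda>a. cayley (w * \<kappa> a)) \<in> borel_measurable M"
    unfolding cayley_def by measurable
qed

lemma cayley_mean_0: "cayley_mean 0 = \<i>"
  by (simp add: cayley_mean_def cayley_def prob_space)

lemma Im_cayley_mean_nonneg:
  assumes "norm w < 1"
  shows "0 \<le> Im (cayley_mean w)"
proof -
  have "Im (cayley_mean w) = (\<integral>a. Im (cayley (w * \<kappa> a)) \<partial>M)"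
    unfolding cayley_mean_def using cayley_integrable[OF assms] by simp
  also have "0 \<le> \<dots>"
    by (rule integral_nonneg_AE)
      (use \<kappa>_norm assms in \<open>auto intro!: Im_cayley_nonneg simp: norm_mult elim!: eventually_mono\<close>)
  finally show ?thesis .
qed

lemma cayley_mean_holomorphic: "cayley_mean holomorphic_on ball 0 1"
proof -
  have "\<exists>d. (cayley_mean has_field_derivative d) (at w)" if w: "w \<in> ball 0 1" for w
  proof -
    define r where "r = (1 - norm w) / 2"
    have r: "r > 0" using w by (simp add: r_def)
    have close: "norm x \<le> 1 - r" if "x \<in> ball w r" for x
      using that norm_triangle_ineq2[of x w] by (auto simp: dist_norm norm_minus_commute r_def field_simps)
    define f' where "f' x a v = - 2 * \<i> * \<kappa> a / (1 + x * \<kappa> a)\<^sup>2 * v" for x v :: complex and a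
    have "((\<lambda>x. \<integral>a. cayley (x * \<kappa> a) \<partial>M) has_derivative (\<lambda>v. \<integral>a. f' w a v \<partial>M)) (at w)"
    proof (rule has_derivative_integral_dominated[where S="{a. norm (\<kappa> a) = 1}" and r=r and C="2 / r\<^sup>2"])
      show "integrable M (\<lambda>a. cayley (x * \<kappa> a))" if "x \<in> ball w r" for x
        using close[OF that] r by (intro cayley_integrable) simp
      fix x v :: complex and a assume x: "x \<in> ball w r" and a: "a \<in> {a. norm (\<kappa> a) = 1}"
      have n: "r \<le> norm (1 + x * \<kappa> a)"
        using norm_diff_ineq[of 1 "x * \<kappa> a"] close[OF x] a by (simp add: norm_mult)
      then have nz: "1 + x * \<kappa> a \<noteq> 0" using r by auto
      have "((\<lambda>x. cayley (x * \<kappa> a)) has_field_derivative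
          (\<i> * (- \<kappa> a) * (1 + x * \<kappa> a) - \<i> * (1 - x * \<kappa> a) * \<kappa> a) / ((1 + x * \<kappa> a) * (1 + x * \<kappa> a))) (at x)"
        unfolding cayley_def using nz by (auto intro!: derivative_eq_intros)
      also have "(\<i> * (- \<kappa> a) * (1 + x * \<kappa> a) - \<i> * (1 - x * \<kappa> a) * \<kappa> a) / ((1 + x * \<kappa> a) * (1 + x * \<kappa> a))
          = - 2 * \<i> * \<kappa> a / (1 + x * \<kappa> a)\<^sup>2"
        by (simp add: power2_eq_square algebra_simps)
      finally show "((\<lambda>x. cayley (x * \<kappa> a)) has_derivative f' x a) (at x)"
        unfolding has_field_derivative_def f'_def .
      have "2 / (norm (1 + x * \<kappa> a))\<^sup>2 \<le> 2 / r\<^sup>2"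
        using n r by (intro divide_left_mono power_mono mult_pos_pos) auto
      then have "2 / (norm (1 + x * \<kappa> a))\<^sup>2 * norm v \<le> 2 / r\<^sup>2 * norm v"
        by (rule mult_right_mono) simp
      then show "norm (f' x a v) \<le> 2 / r\<^sup>2 * norm v"
        using a by (simp add: f'_def norm_mult norm_divide norm_power)
    qed (use r \<kappa>_norm in \<open>auto simp: f'_def finite_measure_axioms\<close>)
    then have "(cayley_mean has_field_derivative (\<integral>a. - 2 * \<i> * \<kappa> a / (1 + w * \<kappa> a)\<^sup>2 \<partial>M)) (at w)"
      unfolding has_field_derivative_def cayley_mean_def[abs_def] f'_def integral_mult_left_zero .
    then show ?thesis by blast
  qed
  then show ?thesis
    by (auto simp: holomorphic_on_open)
qed

text \<open>
  The poles \<open>- 1 / \<kappa> a\<close> of the averaged functions stay away from \<open>\<omega>\<close>, so the functions are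
  bounded on the radius towards \<open>\<omega>\<close> uniformly in \<open>a\<close>.
\<close>

lemma cayley_mean_radial_limit:
  assumes \<omega>: "norm \<omega> = 1" and c: "c > 0" "AE a in M. c \<le> norm (1 + \<omega> * \<kappa> a)"
    and \<rho>: "\<rho> \<longlonglongrightarrow> 1" "\<And>n. 0 \<le> \<rho> n" "\<And>n. \<rho> n \<le> 1"
  shows "(\<lambda>n. cayley_mean (of_real (\<rho> n) * \<omega>)) \<longlonglongrightarrow> cayley_mean \<omega>"
  unfolding cayley_mean_def
proof (rule integral_dominated_convergence[where w="\<lambda>_. 2 / (c / 2)"])
  show "AE a in M. norm (cayley (of_real (\<rho> n) * \<omega> * \<kappa> a)) \<le> 2 / (c / 2)" for n
    using \<kappa>_norm c(2)
  proof eventually_elim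
    case (elim a)
    then have "c \<le> 2 * norm (1 + of_real (\<rho> n) * (\<omega> * \<kappa> a))"
      using norm_one_plus_scaled[of "\<omega> * \<kappa> a" "\<rho> n"] \<omega> \<rho> by (simp add: norm_mult)
    then show ?case
      using c(1) elim \<omega> \<rho> by (intro norm_cayley_le) (auto simp: norm_mult mult.assoc)
  qed
  show "AE a in M. (\<lambda>n. cayley (of_real (\<rho> n) * \<omega> * \<kappa> a)) \<longlonglongrightarrow> cayley (\<omega> * \<kappa> a)"
    using c(2)
  proof eventually_elim
    case (elim a)
    then have "1 + of_real 1 * \<omega> * \<kappa> a \<noteq> 0" using c(1) by auto
    then have "(\<lambda>n. cayley (of_real (\<rho> n) * \<omega> * \<kappa> a)) \<longlonglongrightarrow> cayley (of_real 1 * \<omega> * \<kappa> a)"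
      unfolding cayley_def by (intro tendsto_intros \<rho>(1))
    then show ?case by simp
  qed
qed (auto simp: cayley_def)

text \<open>
  Cauchy's formula for \<open>w \<mapsto> exp (\<i> * t * cayley_mean (w\<^sup>2))\<close> at the centre of the circle of radius
  \<open>r\<close>. The square appears because turning a pair of vectors by an angle turns the argument of the Cayley
  transform by twice that angle.
\<close>

lemma mean_exp_cayley_interior:
  assumes r: "0 < r" "r < 1"
  shows "((\<lambda>s. exp (\<i> * of_real t * cayley_mean ((of_real r * exp (2 * of_real pi * \<i> * of_real s))\<^sup>2))) has_integral
           of_real (exp (- t))) {0..1}"
proof -
  define G where "G w = exp (\<i> * of_real t * cayley_mean (w\<^sup>2))" for w
  have "cayley_mean \<circ> (\<lambda>w. w\<^sup>2) holomorphic_on ball 0 1"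
  proof (rule holomorphic_on_compose_gen[OF _ cayley_mean_holomorphic])
    show "(\<lambda>w. w\<^sup>2) ` ball 0 1 \<subseteq> ball (0::complex) 1"
      by (auto simp: norm_power power_less_one_iff)
  qed (auto intro!: holomorphic_intros)
  then have "G holomorphic_on ball 0 1"
    unfolding G_def comp_def by (intro holomorphic_intros)
  then have "G holomorphic_on cball 0 r"
    by (rule holomorphic_on_subset) (use r in auto)
  from Cauchy_integral_circlepath_simple[OF this, of 0] r
  have "((\<lambda>u. G u / u) has_contour_integral (2 * of_real pi * \<i> * G 0)) (circlepath 0 r)"
    by simp
  then have "((\<lambda>s. 2 * of_real pi * \<i> * G (of_real r * exp (2 * of_real pi * \<i> * of_real s)))
      has_integral (2 * of_real pi * \<i> * G 0)) {0..1}"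
    unfolding has_contour_integral_def
  proof (rule has_integral_eq[rotated])
    fix s :: real assume "s \<in> {0..1}"
    then have "vector_derivative (circlepath 0 r) (at s within {0..1})
        = 2 * of_real pi * \<i> * circlepath 0 r s"
      by (simp add: vector_derivative_circlepath01) (simp add: circlepath ac_simps)
    moreover have "circlepath 0 r s \<noteq> 0" using r by (simp add: circlepath)
    ultimately show "G (circlepath 0 r s) / circlepath 0 r s * vector_derivative (circlepath 0 r) (at s within {0..1})
        = 2 * of_real pi * \<i> * G (of_real r * exp (2 * of_real pi * \<i> * of_real s))"
      by (simp add: circlepath[symmetric]) (simp add: circlepath)
  qed
  from has_integral_mult_right[OF this, of "1 / (2 * of_real pi * \<i>)"]
  have "((\<lambda>s. G (of_real r * exp (2 * of_real pi * \<i> * of_real s))) has_integral G 0) {0..1}"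
    by simp
  moreover have "G 0 = of_real (exp (- t))"
    by (simp add: G_def cayley_mean_0 exp_of_real[symmetric] mult.assoc mult.left_commute[of \<i> "of_real t"])
  ultimately show ?thesis by (simp add: G_def)
qed

text \<open>
  Let \<open>r\<close> tend to 1 in the mean value formula. The integrands are bounded by 1 because
  \<open>cayley_mean\<close> has nonnegative imaginary part on the disc and \<open>t \<ge> 0\<close>. For
  \<open>s\<close> uniform on \<open>{0..1}\<close> the conclusion, taken for all \<open>t \<ge> 0\<close>, says that \<open>h s\<close> is
  Cauchy distributed.
\<close>

lemma mean_exp_cayley_boundary:
  fixes h :: "real \<Rightarrow> real"
  assumes t: "t \<ge> 0"
    and h [measurable]: "h \<in> borel_measurable borel"
    and lim: "AE s in restrict_space lborel {0..1}. complex_of_real (h s) = cayley_mean ((exp (2 * of_real pi * \<i> * of_real s))\<^sup>2)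
        \<and> (\<exists>c>0. AE a in M. c \<le> norm (1 + (exp (2 * of_real pi * \<i> * of_real s))\<^sup>2 * \<kappa> a))"
  shows "(\<integral>s. iexp (t * h s) \<partial>restrict_space lborel {0..1}) = of_real (exp (- t))"
proof -
  define E where "E s = exp (2 * of_real pi * \<i> * of_real s)" for s :: real
  have E: "norm (E s) = 1" for s by (simp add: E_def)
  define r where "r n = 1 - 1 / real (n + 2)" for n
  have r: "0 < r n" "r n < 1" for n by (auto simp: r_def field_simps)
  have "r \<longlonglongrightarrow> 1 - 0"
    unfolding r_def by (intro tendsto_intros LIMSEQ_ignore_initial_segment[OF lim_1_over_n])
  then have r_lim: "(\<lambda>n. (r n)\<^sup>2) \<longlonglongrightarrow> 1"
    using tendsto_power[of r "1 - 0" sequentially 2] by simp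
  let ?U = "restrict_space lborel {0..1::real}"
  interpret U: prob_space ?U
    by (rule prob_space_restrict_space) auto
  define G where "G n s = exp (\<i> * of_real t * cayley_mean ((of_real (r n) * E s)\<^sup>2))" for n s
  have cont: "continuous_on {0..1} (G n)" for n
  proof -
    have "continuous_on (ball 0 1) cayley_mean"
      using cayley_mean_holomorphic by (rule holomorphic_on_imp_continuous_on)
    then have "continuous_on {0..1} (\<lambda>s. cayley_mean ((of_real (r n) * E s)\<^sup>2))"
      by (rule continuous_on_compose2)
        (use r[of n] E in \<open>auto simp: E_def norm_mult norm_power power_less_one_iff intro!: continuous_intros\<close>)
    then show ?thesis unfolding G_def by (intro continuous_intros)
  qed
  have "(\<lambda>n. \<integral>s. G n s \<partial>?U) \<longlonglongrightarrow> (\<integral>s. iexp (t * h s) \<partial>?U)"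
  proof (rule integral_dominated_convergence[where w="\<lambda>_. 1"])
    show "(\<lambda>s. iexp (t * h s)) \<in> borel_measurable ?U"
      by (rule measurable_restrict_space1) measurable
    show "G n \<in> borel_measurable ?U" for n
      using borel_measurable_continuous_on_restrict[OF cont[of n]]
      by (simp cong: measurable_cong_sets add: sets_restrict_space)
    show "AE s in ?U. norm (G n s) \<le> 1" for n
    proof (rule AE_I2)
      fix s
      have "0 \<le> Im (cayley_mean ((of_real (r n) * E s)\<^sup>2))"
        using r[of n] E[of s] by (intro Im_cayley_mean_nonneg) (auto simp: norm_mult norm_power power_less_one_iff)
      then show "norm (G n s) \<le> 1" using t by (simp add: G_def)
    qed
    show "AE s in ?U. (\<lambda>n. G n s) \<longlonglongrightarrow> iexp (t * h s)"
      using lim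
    proof eventually_elim
      case (elim s)
      then obtain c where c: "c > 0" "AE a in M. c \<le> norm (1 + (E s)\<^sup>2 * \<kappa> a)"
        by (auto simp: E_def)
      have "(\<lambda>n. cayley_mean (of_real ((r n)\<^sup>2) * (E s)\<^sup>2)) \<longlonglongrightarrow> cayley_mean ((E s)\<^sup>2)"
      proof (rule cayley_mean_radial_limit[OF _ c r_lim])
        show "norm ((E s)\<^sup>2) = 1" by (simp add: norm_power E)
        show "0 \<le> (r n)\<^sup>2" "(r n)\<^sup>2 \<le> 1" for n using r[of n] by (auto simp: power_le_one)
      qed
      then have "(\<lambda>n. G n s) \<longlonglongrightarrow> exp (\<i> * of_real t * cayley_mean ((E s)\<^sup>2))"
        unfolding G_def power_mult_distrib of_real_power[symmetric] by (intro tendsto_intros)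
      then show ?case using elim by (simp add: E_def mult.assoc)
    qed
  qed auto
  moreover have "(\<integral>s. G n s \<partial>?U) = of_real (exp (- t))" for n
  proof -
    have "(\<integral>s. G n s \<partial>?U) = (LINT s:{0..1}|lborel. G n s)"
      by (subst integral_restrict_space) (auto simp: set_lebesgue_integral_def)
    also have "\<dots> = integral {0..1} (G n)"
      by (rule set_borel_integral_eq_integral) (rule borel_integrable_atLeastAtMost'[OF cont])
    also have "\<dots> = of_real (exp (- t))"
      using mean_exp_cayley_interior[OF r, of t n] by (intro integral_unique) (simp add: G_def[abs_def] E_def)
    finally show ?thesis .
  qed
  ultimately show ?thesis
    by (simp add: LIMSEQ_const_iff)
qed

end

section \<open>Elementary properties of the field and of H\<close>

locale null_directions =
  fixes K :: "'a::euclidean_space set" and \<mu> :: "'a measure"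
  assumes K_sphere: "K \<subseteq> sphere 0 1" and K_compact: "compact K" and K_null: "hausdorff1 K = 0"
    and prob_\<mu>: "prob_space \<mu>" and sets_\<mu> [measurable_cong]: "sets \<mu> = sets borel"
    and \<mu>_K: "emeasure \<mu> (- K) = 0"
begin

sublocale \<mu>: prob_space \<mu> by (rule prob_\<mu>)

lemma AE_K: "AE a in \<mu>. a \<in> K"
proof (rule AE_I')
  show "- K \<in> null_sets \<mu>"
    using K_compact \<mu>_K by (auto simp: null_sets_def sets_\<mu> compact_imp_closed)
qed auto

lemma norm_K: "a \<in> K \<Longrightarrow> norm a = 1"
  using K_sphere by auto

lemma K_nonempty: "K \<noteq> {}"
  using AE_K \<mu>.AE_False by auto

lemma Omega_iff: "x \<in> Omega K \<longleftrightarrow> (\<exists>c>0. \<forall>a\<in>K. c \<le> \<bar>a \<bullet> x\<bar>)"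
  by (rule Omega_bound[OF K_compact K_nonempty])

lemma Omega_nonzero: "x \<in> Omega K \<Longrightarrow> a \<in> K \<Longrightarrow> a \<bullet> x \<noteq> 0"
  by (auto simp: Omega_eq[OF K_compact K_nonempty] orthogonal_directions_def)

lemma open_Omega_K: "open (Omega K)"
  by (rule open_Omega[OF K_compact K_nonempty K_sphere])

lemma Omega_sets [measurable]: "Omega K \<in> sets borel"
  using open_Omega_K by (rule borel_open)

lemma Omega_scale: "x \<in> Omega K \<Longrightarrow> t > 0 \<Longrightarrow> t *\<^sub>R x \<in> Omega K"
  by (auto simp: Omega_eq[OF K_compact K_nonempty] orthogonal_directions_def)

lemma g_mu_measurable [measurable]: "g_mu \<mu> \<in> borel_measurable borel"
  unfolding g_mu_def by measurable

lemma H_mu_measurable [measurable]: "H_mu \<mu> \<in> borel_measurable borel"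
  unfolding H_mu_def by measurable

lemma g_defined_measurable [measurable]: "Measurable.pred borel (g_defined \<mu>)"
  unfolding g_defined_def by measurable

lemma g_defined_AE:
  assumes "g_defined \<mu> x"
  shows "AE a in \<mu>. a \<in> K \<and> a \<bullet> x \<noteq> 0"
proof -
  have "AE a in \<mu>. inverse (ennreal \<bar>a \<bullet> x\<bar>) \<noteq> \<infinity>"
    using assms unfolding g_defined_def by (intro nn_integral_noteq_infinite) auto
  with AE_K show ?thesis
    by eventually_elim auto
qed

lemma g_defined_integrable:
  assumes "g_defined \<mu> x"
  shows "integrable \<mu> (\<lambda>a. a /\<^sub>R (a \<bullet> x))"
proof (rule integrableI_bounded)
  have "(\<integral>\<^sup>+a. ennreal (norm (a /\<^sub>R (a \<bullet> x))) \<partial>\<mu>) = (\<integral>\<^sup>+a. inverse (ennreal \<bar>a \<bullet> x\<bar>) \<partial>\<mu>)"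
  proof (rule nn_integral_cong_AE)
    show "AE a in \<mu>. ennreal (norm (a /\<^sub>R (a \<bullet> x))) = inverse (ennreal \<bar>a \<bullet> x\<bar>)"
      using g_defined_AE[OF assms]
      by eventually_elim (simp add: norm_K inverse_ennreal)
  qed
  then show "(\<integral>\<^sup>+a. ennreal (norm (a /\<^sub>R (a \<bullet> x))) \<partial>\<mu>) < \<infinity>"
    using assms by (simp add: g_defined_def)
qed measurable

lemma inner_g_mu:
  assumes "g_defined \<mu> x"
  shows "v \<bullet> g_mu \<mu> x = (\<integral>a. (a \<bullet> v) / (a \<bullet> x) \<partial>\<mu>)"
  unfolding g_mu_def using g_defined_integrable[OF assms]
  by (subst integral_inner_right[symmetric]) (auto simp: inner_commute divide_inverse mult.commute)

lemma inner_g_mu_self: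
  assumes "g_defined \<mu> x"
  shows "x \<bullet> g_mu \<mu> x = 1"
proof -
  have "x \<bullet> g_mu \<mu> x = (\<integral>a. 1 \<partial>\<mu>)"
    unfolding inner_g_mu[OF assms]
    by (rule integral_cong_AE) (use g_defined_AE[OF assms] in \<open>auto elim: eventually_mono\<close>)
  then show ?thesis by (simp add: \<mu>.prob_space)
qed

lemma g_mu_nonzero: "g_defined \<mu> x \<Longrightarrow> g_mu \<mu> x \<noteq> 0"
  using inner_g_mu_self by force

lemma H_mu_eq_cosine:
  assumes "g_defined \<mu> u"
  shows "H_mu \<mu> u = (u \<bullet> N_mu \<mu> u)\<^sup>2"
  using inner_g_mu_self[OF assms] by (simp add: H_mu_def N_mu_def power_divide divide_inverse power_inverse)

text \<open>
  Cauchy-Schwarz applied to \<open>u \<bullet> g_mu \<mu> u = 1\<close>. The bound is what makes the moments of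
  \<^const>\<open>H_mu\<close> on the sphere determine its law.
\<close>

lemma H_mu_le_1:
  assumes "norm u = 1" "g_defined \<mu> u"
  shows "H_mu \<mu> u \<le> 1"
proof -
  have "1 \<le> norm (g_mu \<mu> u)"
    using Cauchy_Schwarz_ineq2[of u "g_mu \<mu> u"] inner_g_mu_self[OF assms(2)] assms(1) by simp
  then have "1 \<le> (norm (g_mu \<mu> u))\<^sup>2" by (rule one_le_power)
  then show ?thesis by (simp add: H_mu_def divide_le_eq_1)
qed

lemma H_mu_nonneg: "0 \<le> H_mu \<mu> u"
  by (simp add: H_mu_def)

lemma Omega_g_defined:
  assumes "x \<in> Omega K"
  shows "g_defined \<mu> x"
proof -
  obtain c where c: "c > 0" "\<And>a. a \<in> K \<Longrightarrow> c \<le> \<bar>a \<bullet> x\<bar>"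
    using assms Omega_iff by auto
  have "(\<integral>\<^sup>+a. inverse (ennreal \<bar>a \<bullet> x\<bar>) \<partial>\<mu>) \<le> (\<integral>\<^sup>+a. ennreal (1 / c) \<partial>\<mu>)"
  proof (rule nn_integral_mono_AE)
    show "AE a in \<mu>. inverse (ennreal \<bar>a \<bullet> x\<bar>) \<le> ennreal (1 / c)"
      using AE_K
    proof eventually_elim
      case (elim a)
      then have "\<bar>a \<bullet> x\<bar> > 0" using c by force
      then show ?case
        using c elim by (simp add: inverse_ennreal divide_inverse le_imp_inverse_le)
    qed
  qed
  also have "\<dots> < \<infinity>" by (simp add: \<mu>.emeasure_space_1)
  finally show ?thesis by (simp add: g_defined_def)
qed

lemma g_mu_scale: "g_mu \<mu> (c *\<^sub>R x) = g_mu \<mu> x /\<^sub>R c"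
  unfolding g_mu_def by (subst integral_scaleR_right[symmetric]) (simp add: mult.commute)

lemma H_mu_scale: "H_mu \<mu> (c *\<^sub>R x) = c\<^sup>2 * H_mu \<mu> x"
  by (simp add: H_mu_def g_mu_scale power_mult_distrib divide_simps)

lemmas AE_Omega_K = AE_Omega[OF K_compact K_nonempty K_sphere K_null]

section \<open>A Cauchy distributed ratio\<close>

text \<open>
  Rotation of a pair of vectors: \<open>(a \<bullet> x, a \<bullet> y)\<close> is rotated by the angle \<open>2 * pi * s\<close>
  simultaneously for all \<open>a\<close>.
\<close>

definition turn :: "real \<Rightarrow> 'a \<times> 'a \<Rightarrow> 'a \<times> 'a" where
  "turn s z = (cos (2 * pi * s) *\<^sub>R fst z - sin (2 * pi * s) *\<^sub>R snd z,
               sin (2 * pi * s) *\<^sub>R fst z + cos (2 * pi * s) *\<^sub>R snd z)"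

lemma turn_measurable [measurable]:
  "case_prod turn \<in> borel_measurable (borel \<Otimes>\<^sub>M borel)"
  unfolding borel_prod turn_def case_prod_beta
  by (intro borel_measurable_continuous_onI continuous_intros)

lemma turn_orthogonal: "orthogonal_transformation (turn s)"
  unfolding orthogonal_transformation
proof
  show "linear (turn s)"
    by (rule linearI) (auto simp: turn_def algebra_simps)
  have "(norm (turn s z))\<^sup>2 = (norm z)\<^sup>2" for z
  proof -
    obtain x y where z: "z = (x, y)" by force
    define C where "C = cos (2 * pi * s)"
    define S where "S = sin (2 * pi * s)"
    have "C\<^sup>2 + S\<^sup>2 = 1" by (simp add: C_def S_def)
    moreover have "(norm (turn s z))\<^sup>2 = (C\<^sup>2 + S\<^sup>2) * (x \<bullet> x) + (C\<^sup>2 + S\<^sup>2) * (y \<bullet> y)"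
      unfolding power2_norm_eq_inner z turn_def C_def[symmetric] S_def[symmetric]
      by (simp add: inner_Pair algebra_simps inner_add_left inner_add_right inner_diff_left inner_diff_right
          power2_eq_square inner_commute)
    ultimately show ?thesis
      by (simp add: power2_norm_eq_inner z inner_Pair)
  qed
  then show "\<forall>v. norm (turn s v) = norm v" by (metis norm_ge_zero power2_eq_iff_nonneg)
qed

text \<open>
  Writing \<open>\<zeta> a\<close> for \<open>a \<bullet> x + \<i> * (a \<bullet> y)\<close>, the turned pair has
  \<open>E s * \<zeta> a\<close> in place of \<open>\<zeta> a\<close>, and the quotient of imaginary and real part of a complex
  number \<open>\<xi>\<close> is \<open>cayley (\<xi> / cnj \<xi>)\<close>. Averaging over \<open>a\<close> identifies
  \<open>snd (turn s z) \<bullet> g_mu \<mu> (fst (turn s z))\<close> with a boundary value of \<open>cayley_mean\<close>. A single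
  angle with \<open>fst (turn s z) \<in> Omega K\<close> already ensures \<open>\<zeta> a \<noteq> 0\<close> for all \<open>a \<in> K\<close>.
\<close>

lemma mean_iexp_circle:
  assumes AE: "AE s in restrict_space lborel {0..1}. fst (turn s z) \<in> Omega K" and t: "t \<ge> 0"
  shows "(\<integral>s. iexp (t * (snd (turn s z) \<bullet> g_mu \<mu> (fst (turn s z)))) \<partial>restrict_space lborel {0..1})
    = of_real (exp (- t))"
proof -
  obtain x y where z: "z = (x, y)" by force
  define E where "E s = exp (2 * of_real pi * \<i> * of_real s)" for s :: real
  have E: "E s = Complex (cos (2 * pi * s)) (sin (2 * pi * s))" for s
  proof -
    have "E s = cis (2 * pi * s)"
      unfolding E_def cis_conv_exp by (simp add: mult_ac)
    then show ?thesis by (simp add: cis.ctr)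
  qed
  define \<zeta> where "\<zeta> a = Complex (a \<bullet> x) (a \<bullet> y)" for a
  define \<kappa> where "\<kappa> a = \<zeta> a / cnj (\<zeta> a)" for a
  have Re: "Re (E s * \<zeta> a) = a \<bullet> fst (turn s z)" and Im: "Im (E s * \<zeta> a) = a \<bullet> snd (turn s z)" for s a
    by (simp_all add: E \<zeta>_def turn_def z inner_add_right inner_diff_right)
  have E1: "norm (E s) = 1" for s by (simp add: E_def)
  have Ecnj: "E s * cnj (E s) = 1" for s
    using complex_norm_square[of "E s"] E1[of s] by simp
  interpret U: prob_space "restrict_space lborel {0..1::real}"
    by (rule prob_space_restrict_space) auto
  obtain s0 where s0: "fst (turn s0 z) \<in> Omega K"
    using eventually_happens[OF AE] U.ae_filter_bot by auto
  have \<zeta>0: "\<zeta> a \<noteq> 0" if "a \<in> K" for a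
    using Omega_nonzero[OF s0 that] Re[of s0 a] by auto
  have [measurable]: "\<zeta> \<in> borel_measurable borel"
    unfolding \<zeta>_def Complex_eq by measurable
  have [measurable]: "(\<lambda>a. cnj (\<zeta> a)) \<in> borel_measurable borel"
    unfolding \<zeta>_def Complex_eq by (intro borel_measurable_continuous_onI continuous_intros)
  interpret unimodular_mixture \<mu> \<kappa>
  proof
    show "\<kappa> \<in> borel_measurable \<mu>" unfolding \<kappa>_def by measurable
    show "AE a in \<mu>. norm (\<kappa> a) = 1"
      using AE_K by eventually_elim (simp add: \<kappa>_def norm_divide \<zeta>0)
  qed
  have ratio: "(E s)\<^sup>2 * \<kappa> a = (E s * \<zeta> a) / cnj (E s * \<zeta> a)" if "a \<in> K" for s a
  proof -
    have "cnj (E s) \<noteq> 0" "cnj (\<zeta> a) \<noteq> 0" using Ecnj[of s] \<zeta>0[OF that] by auto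
    then show ?thesis
      using Ecnj[of s] by (simp add: \<kappa>_def field_simps power2_eq_square)
  qed
  have [measurable]: "(\<lambda>s. fst (turn s z)) \<in> borel_measurable borel"
    "(\<lambda>s. snd (turn s z)) \<in> borel_measurable borel"
    unfolding turn_def by (auto intro!: borel_measurable_continuous_onI continuous_intros)
  show ?thesis
  proof (rule mean_exp_cayley_boundary[OF t])
    show "(\<lambda>s. snd (turn s z) \<bullet> g_mu \<mu> (fst (turn s z))) \<in> borel_measurable borel"
      by measurable
    show "AE s in restrict_space lborel {0..1}.
        complex_of_real (snd (turn s z) \<bullet> g_mu \<mu> (fst (turn s z))) = cayley_mean ((exp (2 * of_real pi * \<i> * of_real s))\<^sup>2)
        \<and> (\<exists>c>0. AE a in \<mu>. c \<le> norm (1 + (exp (2 * of_real pi * \<i> * of_real s))\<^sup>2 * \<kappa> a))"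
      using AE unfolding E_def[symmetric]
    proof eventually_elim
      case (elim s)
      obtain c where c: "c > 0" "\<And>a. a \<in> K \<Longrightarrow> c \<le> \<bar>a \<bullet> fst (turn s z)\<bar>"
        using elim Omega_iff by auto
      \<comment> \<open>The summand 1 keeps \<open>R\<close> positive.\<close>
      define R where "R = norm x + norm y + 1"
      have R: "R > 0" by (simp add: R_def add_nonneg_pos)
      have sum: "1 + (E s)\<^sup>2 * \<kappa> a = of_real (2 * (a \<bullet> fst (turn s z))) / cnj (E s * \<zeta> a)"
        and dif: "1 - (E s)\<^sup>2 * \<kappa> a = - \<i> * of_real (2 * (a \<bullet> snd (turn s z))) / cnj (E s * \<zeta> a)"
        if "a \<in> K" for a
      proof -
        have nz: "cnj (E s * \<zeta> a) \<noteq> 0" using E1[of s] \<zeta>0[OF that] by auto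
        show "1 + (E s)\<^sup>2 * \<kappa> a = of_real (2 * (a \<bullet> fst (turn s z))) / cnj (E s * \<zeta> a)"
          unfolding ratio[OF that] Re[symmetric] complex_add_cnj[symmetric]
          using nz by (simp add: add_divide_distrib)
        show "1 - (E s)\<^sup>2 * \<kappa> a = - \<i> * of_real (2 * (a \<bullet> snd (turn s z))) / cnj (E s * \<zeta> a)"
        proof -
          have "cnj (E s * \<zeta> a) - E s * \<zeta> a = - \<i> * of_real (2 * Im (E s * \<zeta> a))"
            by (simp add: complex_eq_iff)
          then show ?thesis
            unfolding ratio[OF that] Im[symmetric] using nz by (simp add: diff_divide_distrib[symmetric] diff_divide_eq_iff divide_diff_eq_iff)
        qed
      qed
      have "AE a in \<mu>. 2 * c / R \<le> norm (1 + (E s)\<^sup>2 * \<kappa> a)"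
        using AE_K
      proof eventually_elim
        case (elim a)
        have "norm (\<zeta> a) \<le> \<bar>a \<bullet> x\<bar> + \<bar>a \<bullet> y\<bar>"
          using cmod_le[of "\<zeta> a"] by (simp add: \<zeta>_def)
        also have "\<dots> \<le> norm x + norm y"
          using Cauchy_Schwarz_ineq2[of a x] Cauchy_Schwarz_ineq2[of a y] norm_K[OF elim] by simp
        finally have "norm (\<zeta> a) \<le> R" by (simp add: R_def)
        then show ?case
          unfolding sum[OF elim] using c(1) c(2)[OF elim] \<zeta>0[OF elim]
          by (simp add: norm_divide norm_mult E1 frac_le)
      qed
      moreover have "cayley_mean ((E s)\<^sup>2) = of_real (snd (turn s z) \<bullet> g_mu \<mu> (fst (turn s z)))"
      proof -
        have "cayley_mean ((E s)\<^sup>2) = (\<integral>a. of_real ((a \<bullet> snd (turn s z)) / (a \<bullet> fst (turn s z))) \<partial>\<mu>)"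
          unfolding cayley_mean_def
        proof (rule integral_cong_AE)
          show "AE a in \<mu>. cayley ((E s)\<^sup>2 * \<kappa> a) = of_real ((a \<bullet> snd (turn s z)) / (a \<bullet> fst (turn s z)))"
            using AE_K
          proof eventually_elim
            case (elim a)
            have "cnj (E s * \<zeta> a) \<noteq> 0" using E1[of s] \<zeta>0[OF elim] by auto
            moreover have "a \<bullet> fst (turn s z) \<noteq> 0" using c elim by force
            ultimately show ?case
              unfolding cayley_def sum[OF elim] dif[OF elim] by (simp add: field_simps)
          qed
        qed (auto simp: cayley_def \<kappa>_def)
        also have "\<dots> = of_real (snd (turn s z) \<bullet> g_mu \<mu> (fst (turn s z)))"
          unfolding inner_g_mu[OF Omega_g_defined[OF elim]] by (rule integral_complex_of_real)
        finally show ?thesis .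
      qed
      ultimately show ?case using c(1) R by (intro conjI exI[of _ "2 * c / R"]) auto
    qed
  qed
qed


lemma turn_measurable_unit:
  "(\<lambda>p. turn (fst p) (snd p)) \<in> measurable (restrict_space lborel {0..1} \<Otimes>\<^sub>M gauss) borel"
proof -
  have "(\<lambda>s. s) \<in> measurable (restrict_space lborel {0..1::real}) borel"
    by (rule measurable_restrict_space1) simp
  then have "(\<lambda>p. (fst p, snd p)) \<in> measurable (restrict_space lborel {0..1::real} \<Otimes>\<^sub>M (gauss :: ('a \<times> 'a) measure))
      (borel \<Otimes>\<^sub>M borel)"
    by (intro measurable_Pair measurable_compose[OF measurable_fst]) auto
  from measurable_compose[OF this turn_measurable] show ?thesis by simp
qed

text \<open>
  For each fixed angle this is the nullity of the orthogonal directions combined with the invariance of the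
  Gaussian law; Fubini exchanges the two quantifiers.
\<close>

lemma AE_turn_Omega:
  "AE z in gauss. AE s in restrict_space lborel {0..1}. fst (turn s z) \<in> Omega K"
proof -
  let ?U = "restrict_space lborel {0..1::real}"
  interpret U: prob_space ?U
    by (rule prob_space_restrict_space) auto
  interpret G: prob_space "gauss :: 'a measure" by (rule prob_space_gauss)
  interpret GG: prob_space "gauss :: ('a \<times> 'a) measure" by (rule prob_space_gauss)
  interpret P: pair_prob_space "gauss :: 'a measure" "gauss :: 'a measure" ..
  interpret Q: pair_prob_space ?U "gauss :: ('a \<times> 'a) measure" ..
  have fst_sets: "{z :: 'a \<times> 'a. fst z \<in> Omega K} \<in> sets borel"
    using open_vimage_fst[OF open_Omega_K] by (intro borel_open) (simp add: vimage_def)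
  have "AE z in (gauss :: 'a measure) \<Otimes>\<^sub>M (gauss :: 'a measure). fst z \<in> Omega K"
  proof (rule P.AE_pair_measure)
    show "{z \<in> space ((gauss :: 'a measure) \<Otimes>\<^sub>M (gauss :: 'a measure)). fst z \<in> Omega K}
        \<in> sets (gauss \<Otimes>\<^sub>M gauss)"
      by measurable
    show "AE x in (gauss :: 'a measure). AE y in (gauss :: 'a measure). fst (x, y) \<in> Omega K"
      using AE_Omega_K(2) by simp
  qed
  then have *: "AE z in (gauss :: ('a \<times> 'a) measure). fst z \<in> Omega K"
    unfolding gauss_pair .
  have "AE z in (gauss :: ('a \<times> 'a) measure). fst (turn s z) \<in> Omega K" for s
  proof -
    have "AE z in distr gauss borel (turn s). fst z \<in> Omega K"
      using * unfolding gauss_orthogonal_invariant[OF turn_orthogonal[of s]] .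
    then show ?thesis by (subst (asm) AE_distr_iff) (auto simp: fst_sets)
  qed
  then have "AE s in ?U. AE z in (gauss :: ('a \<times> 'a) measure). fst (turn s z) \<in> Omega K"
    by simp
  then show ?thesis
    using measurable_sets[OF turn_measurable_unit fst_sets]
    by (subst (asm) Q.AE_commute) (auto simp: vimage_def Int_def conj_commute)
qed

text \<open>
  By invariance the expectation may be averaged over all rotations first, and the average over the rotations of
  almost every fixed pair is \<open>exp (- t)\<close>.
\<close>

lemma gauss_pair_char:
  assumes t: "t \<ge> 0"
  shows "(\<integral>z. iexp (t * (snd z \<bullet> g_mu \<mu> (fst z))) \<partial>gauss) = of_real (exp (- t))"
proof -
  let ?U = "restrict_space lborel {0..1::real}" and ?G = "gauss :: ('a \<times> 'a) measure"
  interpret U: prob_space ?U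
    by (rule prob_space_restrict_space) auto
  interpret GG: prob_space ?G by (rule prob_space_gauss)
  interpret Q: pair_prob_space ?U ?G ..
  define f where "f z = iexp (t * (snd z \<bullet> g_mu \<mu> (fst z)))" for z
  have [measurable]: "f \<in> borel_measurable borel"
    unfolding f_def borel_prod[symmetric] by measurable
  have meas: "(\<lambda>(s, z). f (turn s z)) \<in> borel_measurable (?U \<Otimes>\<^sub>M ?G)"
    using measurable_compose[OF turn_measurable_unit \<open>f \<in> borel_measurable borel\<close>]
    by (simp add: case_prod_beta)
  have [measurable]: "(\<lambda>z. \<integral>s. f (turn s z) \<partial>?U) \<in> borel_measurable ?G"
    using measurable_pair_swap[OF meas]
    by (intro U.borel_measurable_lebesgue_integral) (simp add: case_prod_beta)
  have turned: "(\<integral>z. f (turn s z) \<partial>?G) = (\<integral>z. f z \<partial>?G)" for s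
  proof -
    have "(\<integral>z. f z \<partial>?G) = (\<integral>z. f z \<partial>distr ?G borel (turn s))"
      by (simp only: gauss_orthogonal_invariant[OF turn_orthogonal])
    then show ?thesis by (subst (asm) integral_distr) auto
  qed
  have "(\<integral>z. f z \<partial>?G) = (\<integral>s. (\<integral>z. f (turn s z) \<partial>?G) \<partial>?U)"
    using U.prob_space by (simp add: turned)
  also have "\<dots> = (\<integral>z. (\<integral>s. f (turn s z) \<partial>?U) \<partial>?G)"
  proof (rule Q.Fubini_integral[symmetric])
    show "integrable (?U \<Otimes>\<^sub>M ?G) (\<lambda>(s, z). f (turn s z))"
      by (rule Q.integrable_const_bound[where B=1]) (use meas in \<open>auto simp: f_def\<close>)
  qed
  also have "\<dots> = (\<integral>z. of_real (exp (- t)) \<partial>?G)"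
  proof (rule integral_cong_AE)
    show "AE z in ?G. (\<integral>s. f (turn s z) \<partial>?U) = of_real (exp (- t))"
      using AE_turn_Omega unfolding f_def by eventually_elim (rule mean_iexp_circle[OF _ t])
  qed auto
  also have "\<dots> = of_real (exp (- t))"
    using GG.prob_space by simp
  finally show ?thesis by (simp add: f_def)
qed

text \<open>
  Integrating out the second Gaussian vector: conditionally on the first, the ratio is centred normal with
  standard deviation \<open>norm (g_mu \<mu> x)\<close>.
\<close>

lemma gauss_laplace_norm_g_mu:
  assumes t: "t \<ge> 0"
  shows "(\<integral>\<^sup>+x. ennreal (exp (- (t * norm (g_mu \<mu> x))\<^sup>2 / 2)) \<partial>gauss) = ennreal (exp (- t))"
proof -
  let ?G = "gauss :: 'a measure"
  interpret G: prob_space ?G by (rule prob_space_gauss)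
  interpret P: pair_prob_space ?G ?G ..
  have "of_real (exp (- t)) = (\<integral>z. iexp (t * (snd z \<bullet> g_mu \<mu> (fst z))) \<partial>(?G \<Otimes>\<^sub>M ?G))"
    using gauss_pair_char[OF t] by (simp add: gauss_pair)
  also have "\<dots> = (\<integral>x. (\<integral>y. iexp (t * (y \<bullet> g_mu \<mu> x)) \<partial>?G) \<partial>?G)"
    by (subst P.integral_fst'[symmetric])
       (auto intro!: P.integrable_const_bound[where B=1])
  also have "\<dots> = (\<integral>x. of_real (exp (- (t * norm (g_mu \<mu> x))\<^sup>2 / 2)) \<partial>?G)"
    using t by (auto intro!: Bochner_Integration.integral_cong gauss_integral_iexp[of "t *\<^sub>R g_mu \<mu> _", simplified]
        simp: gauss_integral_iexp[of "t *\<^sub>R g_mu \<mu> _", simplified])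
  also have "\<dots> = of_real (\<integral>x. exp (- (t * norm (g_mu \<mu> x))\<^sup>2 / 2) \<partial>?G)"
    by (rule integral_complex_of_real)
  finally have "(\<integral>x. exp (- (t * norm (g_mu \<mu> x))\<^sup>2 / 2) \<partial>?G) = exp (- t)"
    by (simp only: of_real_eq_iff)
  moreover have "integrable ?G (\<lambda>x. exp (- (t * norm (g_mu \<mu> x))\<^sup>2 / 2))"
    by (rule G.integrable_const_bound[where B=1]) auto
  ultimately show ?thesis
    by (subst nn_integral_eq_integral) auto
qed

end

section \<open>Moments of H\<close>

lemma nn_integral_half_gaussian_moment:
  assumes c: "c > 0"
  shows "(\<integral>\<^sup>+t. ennreal (t ^ (2 * m + 1) * exp (- (t * c)\<^sup>2 / 2)) * indicator {0..} t \<partial>lborel)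
    = ennreal (fact m * 2 ^ m * (1 / c\<^sup>2) ^ Suc m)"
proof -
  \<comment> \<open>Substituting \<open>b * t\<close> for \<open>t\<close> turns \<open>(t * c)\<^sup>2 / 2\<close> into \<open>t\<^sup>2\<close>.\<close>
  define b where "b = sqrt 2 / c"
  have b: "b > 0" "(b * c)\<^sup>2 = 2" "b\<^sup>2 = 2 / c\<^sup>2" using c by (auto simp: b_def power_divide)
  have hb: "has_bochner_integral lborel (\<lambda>x::real. indicator {0..} x *\<^sub>R (exp (- x\<^sup>2) * x ^ (2 * m + 1))) (fact m / 2)"
    by (rule gaussian_moment_odd_pos)
  have "(\<integral>\<^sup>+t. ennreal (t ^ (2 * m + 1) * exp (- (t * c)\<^sup>2 / 2)) * indicator {0..} t \<partial>lborel)
      = ennreal b * (\<integral>\<^sup>+t. ennreal ((b * t) ^ (2 * m + 1) * exp (- (b * t * c)\<^sup>2 / 2)) * indicator {0..} (b * t) \<partial>lborel)"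
    using nn_integral_lborel_scale[of "\<lambda>t::real. ennreal (t ^ (2 * m + 1) * exp (- (t * c)\<^sup>2 / 2)) * indicator {0..} t" b] b(1)
    by simp
  also have "(\<lambda>t. ennreal ((b * t) ^ (2 * m + 1) * exp (- (b * t * c)\<^sup>2 / 2)) * indicator {0..} (b * t))
      = (\<lambda>t. ennreal (b ^ (2 * m + 1)) * ennreal (indicator {0..} t *\<^sub>R (exp (- t\<^sup>2) * t ^ (2 * m + 1))))"
  proof
    fix t
    have "(b * t * c)\<^sup>2 / 2 = t\<^sup>2" using b(2) by (simp add: power_mult_distrib)
    then have e: "- (b * t * c)\<^sup>2 / 2 = - t\<^sup>2" by simp
    show "ennreal ((b * t) ^ (2 * m + 1) * exp (- (b * t * c)\<^sup>2 / 2)) * indicator {0..} (b * t)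
      = ennreal (b ^ (2 * m + 1)) * ennreal (indicator {0..} t *\<^sub>R (exp (- t\<^sup>2) * t ^ (2 * m + 1)))"
      unfolding e using b(1)
      by (cases "t \<ge> 0") (auto simp: indicator_def zero_le_mult_iff power_mult_distrib ennreal_mult[symmetric] ac_simps)
  qed
  also have "(\<integral>\<^sup>+t. ennreal (b ^ (2 * m + 1)) * ennreal (indicator {0..} t *\<^sub>R (exp (- t\<^sup>2) * t ^ (2 * m + 1))) \<partial>lborel)
      = ennreal (b ^ (2 * m + 1)) * ennreal (fact m / 2)"
  proof -
    have "(\<integral>\<^sup>+t. ennreal (indicator {0..} t *\<^sub>R (exp (- t\<^sup>2) * t ^ (2 * m + 1))) \<partial>lborel) = ennreal (fact m / 2)"
      using hb by (subst nn_integral_eq_integral) (auto simp: has_bochner_integral_iff indicator_def)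
    then show ?thesis by (subst nn_integral_cmult) auto
  qed
  also have "ennreal b * (ennreal (b ^ (2 * m + 1)) * ennreal (fact m / 2)) = ennreal (b * (b ^ (2 * m + 1) * (fact m / 2)))"
    using b(1) by (simp only: ennreal_mult[symmetric] less_imp_le zero_le_power fact_ge_zero divide_nonneg_pos zero_less_numeral mult_nonneg_nonneg)
  also have "b * (b ^ (2 * m + 1) * (fact m / 2)) = fact m * 2 ^ m * (1 / c\<^sup>2) ^ Suc m"
  proof -
    have "b * b ^ (2 * m + 1) = (b\<^sup>2) ^ Suc m" by (simp add: power_mult power2_eq_square)
    then have "b * b ^ (2 * m + 1) * (fact m / 2) = (2 / c\<^sup>2) ^ Suc m * (fact m / 2)"
      by (simp only: b(3))
    then show ?thesis by (simp add: power_divide mult.assoc)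
  qed
  finally show ?thesis .
qed

text \<open>
  Both sides arise below: \<open>fact (2 * m + 1)\<close> is the integral of \<open>t ^ (2 * m + 1) * exp (- t)\<close>, and
  \<open>fact m * 2 ^ m\<close> comes from the half-line Gaussian moment.
\<close>

lemma fact_odd_pochhammer_half:
  "fact (2 * m + 1) = fact m * 2 ^ m * (2 ^ Suc m * pochhammer (1 / 2) (Suc m) :: real)"
proof (induction m)
  case 0
  show ?case by simp
next
  case (Suc m)
  have "fact (2 * Suc m + 1) = (2 * real m + 3) * (2 * real m + 2) * fact (2 * m + 1)"
    by (simp add: algebra_simps)
  also have "\<dots> = fact (Suc m) * 2 ^ Suc m * (2 ^ Suc (Suc m) * pochhammer (1 / 2) (Suc (Suc m)))"
    unfolding Suc by (simp add: pochhammer_Suc[of _ "Suc m"] del: pochhammer_Suc) (simp add: field_simps)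
  finally show ?case .
qed

context null_directions
begin

text \<open>
  Multiply the identity for the expectation of \<open>exp (- (t * norm (g_mu \<mu> x))\<^sup>2 / 2)\<close> by
  \<open>t ^ (2 * m + 1)\<close> and integrate over \<open>t \<ge> 0\<close>: by Tonelli the left side becomes a multiple of the
  expectation of \<open>norm (g_mu \<mu> x)\<close> to the power \<open>- 2 * (m + 1)\<close>. The values are the moments of the
  chi-squared law with one degree of freedom.
\<close>

lemma gauss_H_mu_moment:
  "(\<integral>\<^sup>+x. ennreal (H_mu \<mu> x ^ k) \<partial>gauss) = ennreal (2 ^ k * pochhammer (1 / 2) k)"
proof (cases k)
  case 0
  then show ?thesis
    using prob_space.emeasure_space_1[OF prob_space_gauss[where 'a='a]] by simp
next
  case (Suc m)
  let ?G = "gauss :: 'a measure"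
  interpret G: prob_space ?G by (rule prob_space_gauss)
  interpret P: pair_sigma_finite "lborel :: real measure" ?G ..
  have "ennreal (fact m * 2 ^ m) * (\<integral>\<^sup>+x. ennreal (H_mu \<mu> x ^ Suc m) \<partial>?G)
      = (\<integral>\<^sup>+x. (\<integral>\<^sup>+t. ennreal (t ^ (2 * m + 1) * exp (- (t * norm (g_mu \<mu> x))\<^sup>2 / 2)) * indicator {0..} t \<partial>lborel) \<partial>?G)"
  proof (subst nn_integral_cmult[symmetric])
    show "(\<integral>\<^sup>+x. ennreal (fact m * 2 ^ m) * ennreal (H_mu \<mu> x ^ Suc m) \<partial>?G)
      = (\<integral>\<^sup>+x. (\<integral>\<^sup>+t. ennreal (t ^ (2 * m + 1) * exp (- (t * norm (g_mu \<mu> x))\<^sup>2 / 2)) * indicator {0..} t \<partial>lborel) \<partial>?G)"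
    proof (rule nn_integral_cong_AE)
      show "AE x in ?G. ennreal (fact m * 2 ^ m) * ennreal (H_mu \<mu> x ^ Suc m)
        = (\<integral>\<^sup>+t. ennreal (t ^ (2 * m + 1) * exp (- (t * norm (g_mu \<mu> x))\<^sup>2 / 2)) * indicator {0..} t \<partial>lborel)"
        using AE_Omega_K(2)
      proof eventually_elim
        case (elim x)
        then have "norm (g_mu \<mu> x) > 0"
          using g_mu_nonzero[OF Omega_g_defined] by simp
        then show ?case
          by (subst nn_integral_half_gaussian_moment) (auto simp: H_mu_def ennreal_mult[symmetric] simp del: power_Suc)
      qed
    qed
  qed measurable
  also have "\<dots> = (\<integral>\<^sup>+t. (\<integral>\<^sup>+x. ennreal (t ^ (2 * m + 1) * exp (- (t * norm (g_mu \<mu> x))\<^sup>2 / 2)) * indicator {0..} t \<partial>?G) \<partial>lborel)"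
    by (rule P.Fubini') measurable
  also have "\<dots> = (\<integral>\<^sup>+t. ennreal (t ^ (2 * m + 1) * exp (- t)) * indicator {0..} t \<partial>lborel)"
  proof (rule nn_integral_cong)
    fix t :: real
    show "(\<integral>\<^sup>+x. ennreal (t ^ (2 * m + 1) * exp (- (t * norm (g_mu \<mu> x))\<^sup>2 / 2)) * indicator {0..} t \<partial>?G)
      = ennreal (t ^ (2 * m + 1) * exp (- t)) * indicator {0..} t"
    proof (cases "t \<ge> 0")
      case True
      then have "(\<integral>\<^sup>+x. ennreal (t ^ (2 * m + 1) * exp (- (t * norm (g_mu \<mu> x))\<^sup>2 / 2)) \<partial>?G)
        = ennreal (t ^ (2 * m + 1)) * (\<integral>\<^sup>+x. ennreal (exp (- (t * norm (g_mu \<mu> x))\<^sup>2 / 2)) \<partial>?G)"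
        by (subst nn_integral_cmult[symmetric]) (auto simp: ennreal_mult)
      then show ?thesis
        using True gauss_laplace_norm_g_mu[OF True] by (simp add: ennreal_mult)
    qed simp
  qed
  also have "\<dots> = ennreal (fact (2 * m + 1))"
    using nn_intergal_power_times_exp_Ici[of "2 * m + 1"] by (simp only: of_nat_fact)
  also have "\<dots> = ennreal (fact m * 2 ^ m) * ennreal (2 ^ k * pochhammer (1 / 2) k)"
    unfolding fact_odd_pochhammer_half Suc
    by (rule ennreal_mult) (auto intro!: mult_nonneg_nonneg less_imp_le[OF pochhammer_pos])
  finally show ?thesis
    unfolding Suc by (subst (asm) ennreal_mult_cancel_left) auto
qed

text \<open>
  \<^const>\<open>H_mu\<close> is homogeneous of degree two, so its Gaussian moments split into a spherical and a
  radial factor.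
\<close>

lemma sphere_H_mu_moment:
  "(\<integral>\<^sup>+u. ennreal (H_mu \<mu> u ^ k) \<partial>uniform_sphere)
    = ennreal (pochhammer (1 / 2) k / pochhammer (DIM('a) / 2) k)"
proof -
  \<comment> \<open>Off the sphere and off \<open>Omega K\<close> the function \<open>H_mu\<close> need not be bounded by 1, as polar integration requires.\<close>
  define f where "f u = (if norm u = 1 \<and> u \<in> Omega K then ennreal (H_mu \<mu> u ^ k) else 0)" for u
  have [measurable]: "f \<in> borel_measurable borel" unfolding f_def by measurable
  have f_eq: "AE u in uniform_sphere. f u = ennreal (H_mu \<mu> u ^ k)"
    using AE_uniform_sphere_mem_sphere AE_Omega_K(3) by eventually_elim (simp add: f_def)
  have f1: "f u \<le> 1" for u
    unfolding f_def using H_mu_le_1[OF _ Omega_g_defined, of u] H_mu_nonneg[of u]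
    by (auto intro!: power_le_one)
  have "ennreal (2 ^ k * pochhammer (1 / 2) k) = (\<integral>\<^sup>+x. ennreal (H_mu \<mu> x ^ k) \<partial>gauss)"
    by (rule gauss_H_mu_moment[symmetric])
  also have "\<dots> = (\<integral>\<^sup>+x. f (x /\<^sub>R norm x) * ennreal (norm x ^ (2 * k)) \<partial>gauss)"
  proof (rule nn_integral_cong_AE)
    show "AE x in gauss. ennreal (H_mu \<mu> x ^ k) = f (x /\<^sub>R norm x) * ennreal (norm x ^ (2 * k))"
      using AE_Omega_K(2)
    proof eventually_elim
      case (elim x)
      then have x: "x \<noteq> 0" using Omega_nonzero K_nonempty by fastforce
      then have "x /\<^sub>R norm x \<in> Omega K" using Omega_scale[OF elim, of "inverse (norm x)"] by simp
      then have "f (x /\<^sub>R norm x) = ennreal (H_mu \<mu> (x /\<^sub>R norm x) ^ k)"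
        using x by (simp add: f_def)
      moreover have "H_mu \<mu> x = H_mu \<mu> (x /\<^sub>R norm x) * (norm x)\<^sup>2"
        using x by (simp add: H_mu_scale power_inverse)
      ultimately show ?case
        by (simp add: ennreal_mult[symmetric] H_mu_nonneg power_mult power_mult_distrib)
    qed
  qed
  also have "\<dots> = (\<integral>\<^sup>+u. f u \<partial>uniform_sphere) * (\<integral>\<^sup>+(x::'a). ennreal (norm x ^ (2 * k)) \<partial>gauss)"
    by (rule gauss_nn_integral_polar[OF _ _ f1]) measurable
  also have "(\<integral>\<^sup>+u. f u \<partial>uniform_sphere) = (\<integral>\<^sup>+u. ennreal (H_mu \<mu> u ^ k) \<partial>uniform_sphere)"
    using f_eq by (rule nn_integral_cong_AE)
  finally have eq: "(\<integral>\<^sup>+u. ennreal (H_mu \<mu> u ^ k) \<partial>uniform_sphere) * ennreal (2 ^ k * pochhammer (DIM('a) / 2) k)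
      = ennreal (2 ^ k * pochhammer (1 / 2) k)"
    by (simp add: gauss_norm_power)
  define q where "q = 2 ^ k * pochhammer (real DIM('a) / 2) k"
  have q: "q > 0" unfolding q_def by (intro mult_pos_pos pochhammer_pos) auto
  have "(\<integral>\<^sup>+u. ennreal (H_mu \<mu> u ^ k) \<partial>uniform_sphere) = ennreal (2 ^ k * pochhammer (1 / 2) k) / ennreal q"
    using q by (simp add: eq[symmetric] q_def[symmetric] ennreal_mult_divide_eq)
  also have "\<dots> = ennreal (2 ^ k * pochhammer (1 / 2) k / q)"
    using q by (intro divide_ennreal) (auto intro!: mult_nonneg_nonneg less_imp_le[OF pochhammer_pos])
  finally show ?thesis by (simp add: q_def)
qed

end

section \<open>Moments determine the Beta law\<close>

text \<open>
  On a bounded interval the Taylor polynomials of the characteristic function, whose coefficients are the moments,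
  converge to it everywhere.
\<close>

lemma real_distribution_eqI_moments:
  assumes M: "real_distribution M" and N: "real_distribution N"
    and bM: "AE x in M. \<bar>x\<bar> \<le> 1" and bN: "AE x in N. \<bar>x\<bar> \<le> 1"
    and eq: "\<And>k. (\<integral>x. x ^ k \<partial>M) = (\<integral>x. x ^ k \<partial>N)"
  shows "M = N"
proof (rule Levy_uniqueness[OF M N], rule ext)
  fix t :: real
  define S where "S n = (\<Sum>k\<le>n. (\<i> * t) ^ k / fact k * (\<integral>x. x ^ k \<partial>M))" for n
  have lim: "S \<longlonglongrightarrow> char L t"
    if L: "real_distribution L" and b: "AE x in L. \<bar>x\<bar> \<le> 1"
      and e: "\<And>k. (\<integral>x. x ^ k \<partial>L) = (\<integral>x. x ^ k \<partial>M)" for L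
  proof -
    interpret real_distribution L by fact
    have pw: "AE x in L. \<bar>x\<bar> ^ k \<le> 1" for k
      using b by eventually_elim (rule power_le_one, auto)
    have int: "integrable L (\<lambda>x. x ^ k)" for k
      by (rule integrable_const_bound[where B=1]) (use pw[of k] in \<open>auto simp: power_abs\<close>)
    have le1: "expectation (\<lambda>x. \<bar>x\<bar> ^ k) \<le> 1" for k
    proof -
      have "expectation (\<lambda>x. \<bar>x\<bar> ^ k) \<le> expectation (\<lambda>x. 1)"
        using integrable_abs[OF int[of k]] pw by (intro integral_mono_AE) (auto simp: power_abs)
      then show ?thesis using prob_space by simp
    qed
    have S: "S n = (\<Sum>k\<le>n. ((\<i> * t) ^ k / fact k) * expectation (\<lambda>x. x ^ k))" for n
      unfolding S_def e ..
    have "(\<lambda>n. S n - char L t) \<longlonglongrightarrow> 0"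
    proof (rule Lim_null_comparison)
      show "eventually (\<lambda>n. norm (S n - char L t) \<le> 2 * (\<bar>t\<bar> ^ n /\<^sub>R fact n)) sequentially"
      proof (rule always_eventually, rule allI)
        fix n
        have "norm (S n - char L t) \<le> 2 * \<bar>t\<bar> ^ n / fact n * expectation (\<lambda>x. \<bar>x\<bar> ^ n)"
          unfolding S norm_minus_commute[of _ "char L t"] by (rule char_approx1) (rule int)
        also have "\<dots> \<le> 2 * \<bar>t\<bar> ^ n / fact n * 1"
          by (intro mult_left_mono le1) auto
        finally show "norm (S n - char L t) \<le> 2 * (\<bar>t\<bar> ^ n /\<^sub>R fact n)"
          by (simp add: divide_inverse ac_simps)
      qed
      show "(\<lambda>n. 2 * (\<bar>t\<bar> ^ n /\<^sub>R fact n)) \<longlonglongrightarrow> 0"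
        by (rule tendsto_mult_right_zero, rule summable_LIMSEQ_zero, rule summable_exp_generic)
    qed
    then show ?thesis by (simp add: LIM_zero_iff)
  qed
  show "char M t = char N t"
    by (rule LIMSEQ_unique[OF lim[OF M bM refl] lim[OF N bN eq[symmetric]]])
qed

lemma beta_density_nonneg:
  assumes "\<alpha> > 0" "\<beta> > 0"
  shows "0 \<le> beta_density \<alpha> \<beta> x"
proof -
  have "Beta \<alpha> \<beta> > 0" using assms by (simp add: Beta_def Gamma_real_pos)
  then show ?thesis by (simp add: beta_density_def)
qed

lemma beta_density_measurable [measurable]: "beta_density \<alpha> \<beta> \<in> borel_measurable borel"
  unfolding beta_density_def by measurable

lemma Beta_pochhammer:
  fixes \<alpha> \<beta> :: real
  assumes "\<alpha> > 0" "\<beta> > 0"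
  shows "Beta (\<alpha> + real k) \<beta> / Beta \<alpha> \<beta> = pochhammer \<alpha> k / pochhammer (\<alpha> + \<beta>) k"
proof -
  have nn: "x \<notin> \<int>\<^sub>\<le>\<^sub>0" if "x > 0" for x :: real
    using that by (auto elim!: nonpos_Ints_cases)
  have "Gamma \<beta> \<noteq> 0"
    using assms(2) by (metis Gamma_real_pos less_irrefl)
  then show ?thesis
    using assms by (simp add: pochhammer_Gamma nn Beta_def add_ac)
qed

lemma beta_density_moment:
  assumes "\<alpha> > 0" "\<beta> > 0"
  shows "(\<integral>\<^sup>+x. ennreal (beta_density \<alpha> \<beta> x) * ennreal (x ^ k) \<partial>lborel)
    = ennreal (pochhammer \<alpha> k / pochhammer (\<alpha> + \<beta>) k)"
proof -
  have B: "Beta \<alpha> \<beta> > 0" using assms by (simp add: Beta_def Gamma_real_pos)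
  let ?f = "\<lambda>x. x powr (\<alpha> + real k - 1) * (1 - x) powr (\<beta> - 1) / Beta \<alpha> \<beta>"
  have "(?f has_integral Beta (\<alpha> + real k) \<beta> / Beta \<alpha> \<beta>) {0..1}"
    using assms by (intro has_integral_divide has_integral_Beta_real) auto
  from nn_integral_has_integral_lebesgue'[OF _ this] B
  have "(\<integral>\<^sup>+x. ennreal (?f x) * indicator {0..1} x \<partial>lborel) = ennreal (Beta (\<alpha> + real k) \<beta> / Beta \<alpha> \<beta>)"
    by simp
  moreover have "(\<integral>\<^sup>+x. ennreal (?f x) * indicator {0..1} x \<partial>lborel)
      = (\<integral>\<^sup>+x. ennreal (beta_density \<alpha> \<beta> x) * ennreal (x ^ k) \<partial>lborel)"
  proof (rule nn_integral_cong_AE)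
    show "AE x in lborel. ennreal (?f x) * indicator {0..1} x = ennreal (beta_density \<alpha> \<beta> x) * ennreal (x ^ k)"
      using AE_lborel_singleton[of "0::real"] AE_lborel_singleton[of "1::real"]
    proof eventually_elim
      case (elim x)
      show ?case
      proof (cases "0 < x \<and> x < 1")
        case True
        have "\<alpha> + real k - 1 = (\<alpha> - 1) + real k" by simp
        then have "x powr (\<alpha> + real k - 1) = x powr (\<alpha> - 1) * x ^ k"
          using True by (simp only: powr_add powr_realpow)
        then show ?thesis
          using True B by (simp add: beta_density_def ennreal_mult[symmetric] mult_ac)
      next
        case False
        then have "x < 0 \<or> 1 < x" using elim by linarith
        then show ?thesis by (auto simp: beta_density_def)
      qed
    qed
  qed
  ultimately show ?thesis by (simp add: Beta_pochhammer[OF assms])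
qed

lemma real_distribution_beta:
  assumes "\<alpha> > 0" "\<beta> > 0"
  shows "real_distribution (density lborel (\<lambda>x. ennreal (beta_density \<alpha> \<beta> x)))"
proof -
  let ?D = "density lborel (\<lambda>x. ennreal (beta_density \<alpha> \<beta> x))"
  have "emeasure ?D (space ?D) = 1"
    using beta_density_moment[OF assms, of 0] by (simp add: emeasure_density)
  then show ?thesis
    by (intro real_distribution.intro real_distribution_axioms.intro prob_spaceI) auto
qed

context null_directions
begin

lemma distr_sphere_H_mu:
  assumes "DIM('a) \<ge> 2"
  shows "distr uniform_sphere borel (H_mu \<mu>)
    = density lborel (\<lambda>x. ennreal (beta_density (1 / 2) ((real DIM('a) - 1) / 2) x))"
proof (rule real_distribution_eqI_moments)
  define \<beta> where "\<beta> = (real DIM('a) - 1) / 2"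
  have \<beta>: "\<beta> > 0" "1 / 2 + \<beta> = DIM('a) / 2" using assms by (auto simp: \<beta>_def field_simps)
  interpret S: prob_space "uniform_sphere :: 'a measure" by (rule prob_space_uniform_sphere)
  show "real_distribution (distr uniform_sphere borel (H_mu \<mu>))"
    by (rule S.real_distribution_distr) measurable
  show "real_distribution (density lborel (\<lambda>x. ennreal (beta_density (1 / 2) ((real DIM('a) - 1) / 2) x)))"
    unfolding \<beta>_def[symmetric] using \<beta> by (intro real_distribution_beta) auto
  show "AE x in distr uniform_sphere borel (H_mu \<mu>). \<bar>x\<bar> \<le> 1"
  proof (subst AE_distr_iff)
    show "AE u in uniform_sphere. \<bar>H_mu \<mu> u\<bar> \<le> 1"
      using AE_uniform_sphere_mem_sphere AE_Omega_K(3)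
      by eventually_elim (simp add: H_mu_nonneg H_mu_le_1 Omega_g_defined)
  qed auto
  show "AE x in density lborel (\<lambda>x. ennreal (beta_density (1 / 2) ((real DIM('a) - 1) / 2) x)). \<bar>x\<bar> \<le> 1"
    by (subst AE_density) (auto simp: beta_density_def)
  fix k
  define m where "m = pochhammer (1 / 2) k / pochhammer (real DIM('a) / 2) k"
  have m: "m \<ge> 0" unfolding m_def by (intro divide_nonneg_nonneg less_imp_le[OF pochhammer_pos]) auto
  have "(\<integral>x. x ^ k \<partial>distr uniform_sphere borel (H_mu \<mu>)) = (\<integral>u. H_mu \<mu> u ^ k \<partial>uniform_sphere)"
    by (subst integral_distr) auto
  also have "\<dots> = m"
    using sphere_H_mu_moment[of k] m
    by (subst integral_eq_nn_integral) (auto simp: H_mu_nonneg m_def[symmetric])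
  also have "m = (\<integral>x. beta_density (1 / 2) \<beta> x * x ^ k \<partial>lborel)"
  proof -
    have pos: "0 \<le> beta_density (1 / 2) \<beta> x * x ^ k" for x
      using \<beta> beta_density_nonneg[of "1 / 2" \<beta> x] by (cases "x > 0") (auto simp: beta_density_def)
    have "ennreal (beta_density (1 / 2) \<beta> x * x ^ k) = ennreal (beta_density (1 / 2) \<beta> x) * ennreal (x ^ k)" for x
      using \<beta> beta_density_nonneg[of "1 / 2" \<beta> x] by (intro ennreal_mult') auto
    then show ?thesis
      using beta_density_moment[of "1 / 2" \<beta> k] \<beta> m pos
      by (subst integral_eq_nn_integral) (auto simp: m_def[symmetric])
  qed
  also have "\<dots> = (\<integral>x. x ^ k \<partial>density lborel (\<lambda>x. ennreal (beta_density (1 / 2) \<beta> x)))"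
    using \<beta> by (subst integral_density) (auto intro!: beta_density_nonneg)
  finally show "(\<integral>x. x ^ k \<partial>distr uniform_sphere borel (H_mu \<mu>))
    = (\<integral>x. x ^ k \<partial>density lborel (\<lambda>x. ennreal (beta_density (1 / 2) ((real DIM('a) - 1) / 2) x)))"
    by (simp add: \<beta>_def)
qed

end

section \<open>Smoothness of the potential\<close>

lemma has_real_derivative_ln_abs:
  assumes "s \<noteq> 0"
  shows "((\<lambda>s. ln \<bar>s\<bar>) has_real_derivative 1 / s) (at s)"
proof (cases "s > 0")
  case True
  have "(ln has_real_derivative 1 / s) (at s)" by (rule DERIV_ln_divide[OF True])
  then show ?thesis
    by (rule has_field_derivative_transform_within_open[of _ _ _ "{0<..}"]) (use True in auto)
next
  case False
  with assms have s: "- s > 0" by simp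
  have "((\<lambda>s. ln (- s)) has_real_derivative 1 / s) (at s)"
    using s by (auto intro!: derivative_eq_intros)
  then show ?thesis
    by (rule has_field_derivative_transform_within_open[of _ _ _ "{..<0}"]) (use s in auto)
qed

lemma has_real_derivative_inverse_power:
  fixes b :: real
  assumes "s \<noteq> 0"
  shows "((\<lambda>s. b / s ^ k) has_real_derivative - (real k * b) / s ^ Suc k) (at s)"
proof (cases k)
  case (Suc m)
  have "((\<lambda>s. b / s ^ k) has_real_derivative - (b * (real k * s ^ (k - 1))) / (s ^ k * s ^ k)) (at s)"
    using assms by (auto intro!: derivative_eq_intros)
  also have "- (b * (real k * s ^ (k - 1))) / (s ^ k * s ^ k) = - (real k * b) / s ^ Suc k"
    using assms Suc by (simp add: field_simps)
  finally show ?thesis .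
qed simp

lemma infdist_origin_hyperplane:
  fixes a :: "'a::euclidean_space"
  assumes "a \<noteq> 0"
  shows "infdist 0 {x. a \<bullet> x = 1} = 1 / norm a"
proof (rule antisym)
  have "a \<bullet> (a /\<^sub>R (norm a)\<^sup>2) = 1"
    using assms by (simp add: power2_norm_eq_inner[symmetric])
  then have "infdist 0 {x. a \<bullet> x = 1} \<le> dist 0 (a /\<^sub>R (norm a)\<^sup>2)"
    by (intro infdist_le) simp
  also have "\<dots> = 1 / norm a"
    using assms by (simp add: dist_norm power2_eq_square field_simps)
  finally show "infdist 0 {x. a \<bullet> x = 1} \<le> 1 / norm a" .
  have "{x. a \<bullet> x = 1} \<noteq> {}" using \<open>a \<bullet> (a /\<^sub>R (norm a)\<^sup>2) = 1\<close> by blast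
  then show "1 / norm a \<le> infdist 0 {x. a \<bullet> x = 1}"
  proof (subst infdist_notempty, simp, intro cINF_greatest)
    fix x assume "x \<in> {x. a \<bullet> x = 1}"
    then have "1 \<le> norm a * norm x"
      using Cauchy_Schwarz_ineq2[of a x] by simp
    then show "1 / norm a \<le> dist 0 x"
      using assms by (simp add: dist_norm field_simps)
  qed
qed

text \<open>
  Smoothness is the largest property of differentiable functions that their directional derivatives inherit, so
  it suffices to find one class of differentiable functions that contains \<open>f\<close> and the derivatives of its members.
\<close>

lemma smooth_on_coinduct:
  fixes \<F> :: "('a::real_normed_vector \<Rightarrow> 'b::real_normed_vector) \<Rightarrow> bool"
  assumes S: "open S"
    and step: "\<And>f. \<F> f \<Longrightarrow> \<exists>D. (\<forall>x\<in>S. (f has_derivative (\<lambda>v. D v x)) (at x)) \<and> (\<forall>v. \<F> (D v))"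
    and f: "\<F> f"
  shows "smooth_on S f"
proof -
  \<comment> \<open>\<open>frechet_derivative\<close> is tied to \<open>D\<close> only on \<open>S\<close>, so the induction runs over functions that agree with a member of the class on \<open>S\<close>.\<close>
  have "Ck_on k S h" if "\<F> f" "\<And>x. x \<in> S \<Longrightarrow> h x = f x" for k f h
    using that
  proof (induction k arbitrary: f h)
    case 0
    obtain D where D: "\<And>x. x \<in> S \<Longrightarrow> (f has_derivative (\<lambda>v. D v x)) (at x)"
      using step[OF 0(1)] by blast
    have "continuous_on S f"
      by (rule has_derivative_continuous_on) (rule has_derivative_at_withinI[OF D])
    then show ?case
      using 0(2) by (simp cong: continuous_on_cong)
  next
    case (Suc k)
    obtain D where D: "\<And>x. x \<in> S \<Longrightarrow> (f has_derivative (\<lambda>v. D v x)) (at x)" "\<And>v. \<F> (D v)"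
      using step[OF Suc.prems(1)] by blast
    have h: "(h has_derivative (\<lambda>v. D v x)) (at x)" if "x \<in> S" for x
      using D(1)[OF that] S that by (rule has_derivative_transform_within_open) (simp add: Suc.prems(2))
    have "frechet_derivative h (at x) v = D v x" if "x \<in> S" for x v
      using frechet_derivative_at[OF h[OF that]] by metis
    then have "Ck_on k S (\<lambda>x. frechet_derivative h (at x) v)" for v
      by (intro Suc.IH[OF D(2)]) auto
    then show ?case
      using h by (auto simp: differentiable_def)
  qed
  with f show ?thesis unfolding smooth_on_def by blast
qed

context null_directions
begin

text \<open>
  Differentiation of averages of functions of \<open>a \<bullet> x\<close>. Near a point of \<open>Omega K\<close> the values
  \<open>\<bar>a \<bullet> y\<bar>\<close> stay in some \<open>{c..1 / c}\<close>, so bounds on such sets suffice.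
\<close>

lemma ridge_integral_derivative:
  fixes \<psi> \<psi>' :: "'a \<Rightarrow> real \<Rightarrow> real"
  assumes x: "x \<in> Omega K"
    and meas [measurable]: "\<And>x. (\<lambda>a. \<psi> a (a \<bullet> x)) \<in> borel_measurable borel"
      "\<And>x. (\<lambda>a. \<psi>' a (a \<bullet> x)) \<in> borel_measurable borel"
    and deriv: "\<And>a s. a \<in> K \<Longrightarrow> s \<noteq> 0 \<Longrightarrow> (\<psi> a has_real_derivative \<psi>' a s) (at s)"
    and bound: "\<And>c. c > 0 \<Longrightarrow> \<exists>B. \<forall>a\<in>K. \<forall>s. c \<le> \<bar>s\<bar> \<longrightarrow> \<bar>s\<bar> \<le> 1 / c \<longrightarrow> \<bar>\<psi> a s\<bar> \<le> B \<and> \<bar>\<psi>' a s\<bar> \<le> B"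
  shows "integrable \<mu> (\<lambda>a. \<psi> a (a \<bullet> x))"
    and "((\<lambda>x. \<integral>a. \<psi> a (a \<bullet> x) \<partial>\<mu>) has_derivative (\<lambda>v. \<integral>a. (a \<bullet> v) * \<psi>' a (a \<bullet> x) \<partial>\<mu>)) (at x)"
proof -
  obtain r where r: "r > 0" "\<And>y a. y \<in> ball x r \<Longrightarrow> a \<in> K \<Longrightarrow> r \<le> \<bar>a \<bullet> y\<bar>"
    using Omega_ball[OF K_compact K_nonempty K_sphere x] by blast
  \<comment> \<open>Both \<open>c \<le> \<bar>a \<bullet> y\<bar>\<close> and \<open>\<bar>a \<bullet> y\<bar> \<le> 1 / c\<close> are to hold on the ball.\<close>
  define c where "c = min r (1 / (norm x + r))"
  have xr: "norm x + r > 0" using r(1) by (simp add: add_nonneg_pos)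
  have c: "c > 0" using r(1) xr by (simp add: c_def)
  have range: "c \<le> \<bar>a \<bullet> y\<bar>" "\<bar>a \<bullet> y\<bar> \<le> 1 / c" if y: "y \<in> ball x r" and a: "a \<in> K" for y a
  proof -
    show "c \<le> \<bar>a \<bullet> y\<bar>" using r(2)[OF y a] by (simp add: c_def)
    have "\<bar>a \<bullet> y\<bar> \<le> norm y" using Cauchy_Schwarz_ineq2[of a y] norm_K[OF a] by simp
    also have "\<dots> \<le> norm x + r"
      using y norm_triangle_ineq2[of y x] by (simp add: dist_norm norm_minus_commute)
    also have "\<dots> \<le> 1 / c"
      using c xr by (simp add: c_def field_simps min_def split: if_splits)
    finally show "\<bar>a \<bullet> y\<bar> \<le> 1 / c" .
  qed
  obtain B0 where B0: "\<And>a s. a \<in> K \<Longrightarrow> c \<le> \<bar>s\<bar> \<Longrightarrow> \<bar>s\<bar> \<le> 1 / c \<Longrightarrow> \<bar>\<psi> a s\<bar> \<le> B0 \<and> \<bar>\<psi>' a s\<bar> \<le> B0"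
    using bound[OF c] by blast
  define B where "B = max B0 0"
  have B: "\<bar>\<psi> a (a \<bullet> y)\<bar> \<le> B" "\<bar>\<psi>' a (a \<bullet> y)\<bar> \<le> B" if "y \<in> ball x r" "a \<in> K" for y a
    using B0[OF that(2) range[OF that]] by (auto simp: B_def)
  have int: "integrable \<mu> (\<lambda>a. \<psi> a (a \<bullet> y))" if "y \<in> ball x r" for y
    by (rule \<mu>.integrable_const_bound[where B=B])
      (use AE_K B(1)[OF that] in \<open>auto elim!: eventually_mono\<close>)
  then show "integrable \<mu> (\<lambda>a. \<psi> a (a \<bullet> x))" using r(1) by simp
  show "((\<lambda>x. \<integral>a. \<psi> a (a \<bullet> x) \<partial>\<mu>) has_derivative (\<lambda>v. \<integral>a. (a \<bullet> v) * \<psi>' a (a \<bullet> x) \<partial>\<mu>)) (at x)"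
  proof (rule has_derivative_integral_dominated[OF \<mu>.finite_measure_axioms r(1) _ int AE_K])
    show "0 \<le> B" by (simp add: B_def)
    fix y a v assume y: "y \<in> ball x r" and a: "a \<in> K"
    have "a \<bullet> y \<noteq> 0" using range(1)[OF y a] c by auto
    have lin: "((\<lambda>y. a \<bullet> y) has_derivative (\<lambda>v. a \<bullet> v)) (at y)"
      by (rule bounded_linear.has_derivative[OF bounded_linear_inner_right]) (rule has_derivative_ident)
    show "((\<lambda>y. \<psi> a (a \<bullet> y)) has_derivative (\<lambda>v. (a \<bullet> v) * \<psi>' a (a \<bullet> y))) (at y)"
      by (rule DERIV_compose_FDERIV[OF _ lin]) (rule deriv[OF a \<open>a \<bullet> y \<noteq> 0\<close>])
    have "\<bar>a \<bullet> v\<bar> * \<bar>\<psi>' a (a \<bullet> y)\<bar> \<le> norm v * B"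
      using Cauchy_Schwarz_ineq2[of a v] norm_K[OF a] B(2)[OF y a]
      by (intro mult_mono) auto
    then show "norm ((a \<bullet> v) * \<psi>' a (a \<bullet> y)) \<le> B * norm v"
      by (simp add: abs_mult mult.commute)
  qed auto
qed

definition log_Phi :: "'a \<Rightarrow> real" where
  "log_Phi x = (\<integral>a. ln \<bar>a \<bullet> x\<bar> \<partial>\<mu>)"

lemma Phi_eq: "Phi K \<mu> x = exp (log_Phi x)"
proof -
  have [measurable]: "K \<in> sets \<mu>" using K_compact by (simp add: sets_\<mu> compact_imp_closed)
  have "(LINT a:K|\<mu>. ln \<bar>a \<bullet> x\<bar>) = log_Phi x"
    unfolding set_lebesgue_integral_def log_Phi_def
    by (rule integral_cong_AE) (use AE_K in \<open>auto elim!: eventually_mono\<close>)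
  then show ?thesis by (simp add: Phi_def)
qed

lemma log_Phi_derivative:
  assumes "x \<in> Omega K"
  shows "integrable \<mu> (\<lambda>a. ln \<bar>a \<bullet> x\<bar>)"
    and "(log_Phi has_derivative (\<lambda>v. \<integral>a. (a \<bullet> v) / (a \<bullet> x) ^ 1 \<partial>\<mu>)) (at x)"
proof -
  have bd: "\<exists>B. \<forall>a\<in>K. \<forall>s. c \<le> \<bar>s\<bar> \<longrightarrow> \<bar>s\<bar> \<le> 1 / c \<longrightarrow> \<bar>ln \<bar>s\<bar>\<bar> \<le> B \<and> \<bar>1 / s\<bar> \<le> B"
    if c: "c > 0" for c :: real
  proof (intro exI[of _ "max \<bar>ln c\<bar> (1 / c)"] ballI allI impI conjI)
    fix s :: real assume s: "c \<le> \<bar>s\<bar>" "\<bar>s\<bar> \<le> 1 / c"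
    have "ln c \<le> ln \<bar>s\<bar>" using s c by simp
    moreover have "ln \<bar>s\<bar> \<le> ln (1 / c)" using s c by (subst ln_le_cancel_iff) auto
    ultimately show "\<bar>ln \<bar>s\<bar>\<bar> \<le> max \<bar>ln c\<bar> (1 / c)" using c by (auto simp: ln_div)
    show "\<bar>1 / s\<bar> \<le> max \<bar>ln c\<bar> (1 / c)"
      using s c by (simp add: le_max_iff_disj frac_le)
  qed
  note d = ridge_integral_derivative[OF assms, of "\<lambda>_ s. ln \<bar>s\<bar>" "\<lambda>_ s. 1 / s",
    OF _ _ has_real_derivative_ln_abs bd]
  show "integrable \<mu> (\<lambda>a. ln \<bar>a \<bullet> x\<bar>)" by (rule d(1)) auto
  have "((\<lambda>x. \<integral>a. ln \<bar>a \<bullet> x\<bar> \<partial>\<mu>) has_derivative (\<lambda>v. \<integral>a. (a \<bullet> v) * (1 / (a \<bullet> x)) \<partial>\<mu>)) (at x)"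
    by (rule d(2)) auto
  then show "(log_Phi has_derivative (\<lambda>v. \<integral>a. (a \<bullet> v) / (a \<bullet> x) ^ 1 \<partial>\<mu>)) (at x)"
    by (simp add: log_Phi_def[abs_def])
qed

lemma inverse_power_integral_derivative:
  assumes x: "x \<in> Omega K" and h [measurable]: "h \<in> borel_measurable borel" and b: "\<And>a. a \<in> K \<Longrightarrow> \<bar>h a\<bar> \<le> b"
  shows "((\<lambda>x. \<integral>a. h a / (a \<bullet> x) ^ k \<partial>\<mu>) has_derivative
    (\<lambda>v. \<integral>a. (- real k * h a * (a \<bullet> v)) / (a \<bullet> x) ^ Suc k \<partial>\<mu>)) (at x)"
proof -
  have "b \<ge> 0" using b K_nonempty by fastforce
  have "((\<lambda>x. \<integral>a. h a / (a \<bullet> x) ^ k \<partial>\<mu>) has_derivative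
      (\<lambda>v. \<integral>a. (a \<bullet> v) * (- (real k * h a) / (a \<bullet> x) ^ Suc k) \<partial>\<mu>)) (at x)"
  proof (rule ridge_integral_derivative(2)[OF x, where \<psi>="\<lambda>a s. h a / s ^ k" and \<psi>'="\<lambda>a s. - (real k * h a) / s ^ Suc k"])
    fix c :: real assume c: "c > 0"
    show "\<exists>B. \<forall>a\<in>K. \<forall>s. c \<le> \<bar>s\<bar> \<longrightarrow> \<bar>s\<bar> \<le> 1 / c \<longrightarrow> \<bar>h a / s ^ k\<bar> \<le> B \<and> \<bar>- (real k * h a) / s ^ Suc k\<bar> \<le> B"
    proof (intro exI[of _ "max (b / c ^ k) (real k * b / c ^ Suc k)"] ballI allI impI conjI)
      fix a s assume a: "a \<in> K" and s: "c \<le> \<bar>s\<bar>"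
      have "\<bar>h a\<bar> / \<bar>s\<bar> ^ k \<le> b / c ^ k"
        using b[OF a] s c \<open>b \<ge> 0\<close> by (intro frac_le power_mono) auto
      then show "\<bar>h a / s ^ k\<bar> \<le> max (b / c ^ k) (real k * b / c ^ Suc k)"
        by (simp add: power_abs)
      have "real k * \<bar>h a\<bar> / \<bar>s\<bar> ^ Suc k \<le> real k * b / c ^ Suc k"
        using b[OF a] s c \<open>b \<ge> 0\<close> by (intro frac_le power_mono mult_left_mono) auto
      then show "\<bar>- (real k * h a) / s ^ Suc k\<bar> \<le> max (b / c ^ k) (real k * b / c ^ Suc k)"
        by (simp add: power_abs abs_mult)
    qed
  next
    show "((\<lambda>s. h a / s ^ k) has_real_derivative - (real k * h a) / s ^ Suc k) (at s)" if "s \<noteq> 0" for a s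
      using that by (rule has_real_derivative_inverse_power)
  qed measurable
  then show ?thesis by (simp add: mult_ac del: power_Suc)
qed

text \<open>
  The iterated directional derivatives of \<open>Phi K \<mu>\<close> are sums of products of \<open>Phi K \<mu>\<close> with averages
  of \<open>h a / (a \<bullet> x) ^ k\<close>, where \<open>h\<close> is a multiple of a product of inner products with fixed vectors.
  The class admits all \<open>h\<close> that are bounded on \<open>K\<close>, a condition that passes to \<open>h a * (a \<bullet> v)\<close>.
\<close>

inductive Phi_class :: "('a \<Rightarrow> real) \<Rightarrow> bool" where
  Phi: "Phi_class (Phi K \<mu>)"
| inverse_power: "h \<in> borel_measurable borel \<Longrightarrow> (\<And>a. a \<in> K \<Longrightarrow> \<bar>h a\<bar> \<le> b) \<Longrightarrow>
    Phi_class (\<lambda>x. \<integral>a. h a / (a \<bullet> x) ^ k \<partial>\<mu>)"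
| add: "Phi_class f \<Longrightarrow> Phi_class g \<Longrightarrow> Phi_class (\<lambda>x. f x + g x)"
| mult: "Phi_class f \<Longrightarrow> Phi_class g \<Longrightarrow> Phi_class (\<lambda>x. f x * g x)"

lemma Phi_class_derivative:
  assumes "Phi_class f"
  shows "\<exists>D. (\<forall>x\<in>Omega K. (f has_derivative (\<lambda>v. D v x)) (at x)) \<and> (\<forall>v. Phi_class (D v))"
  using assms
proof induction
  case Phi
  define D where "D v x = Phi K \<mu> x * (\<integral>a. (a \<bullet> v) / (a \<bullet> x) ^ 1 \<partial>\<mu>)" for v x
  have "(Phi K \<mu> has_derivative (\<lambda>v. D v x)) (at x)" if "x \<in> Omega K" for x
    unfolding Phi_eq[abs_def] D_def Phi_eq
    using log_Phi_derivative(2)[OF that] by (auto intro!: derivative_eq_intros)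
  moreover have "Phi_class (D v)" for v
    unfolding D_def
  proof (intro Phi_class.mult Phi_class.Phi Phi_class.inverse_power)
    show "\<bar>a \<bullet> v\<bar> \<le> norm v" if "a \<in> K" for a
      using Cauchy_Schwarz_ineq2[of a v] norm_K[OF that] by simp
  qed measurable
  ultimately show ?case by blast
next
  case (inverse_power h b k)
  define D where "D v x = (\<integral>a. (- real k * h a * (a \<bullet> v)) / (a \<bullet> x) ^ Suc k \<partial>\<mu>)" for v x
  have "((\<lambda>x. \<integral>a. h a / (a \<bullet> x) ^ k \<partial>\<mu>) has_derivative (\<lambda>v. D v x)) (at x)" if "x \<in> Omega K" for x
    unfolding D_def using that inverse_power by (rule inverse_power_integral_derivative)
  moreover have "Phi_class (D v)" for v
    unfolding D_def
  proof (rule Phi_class.inverse_power)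
    show "\<bar>- real k * h a * (a \<bullet> v)\<bar> \<le> real k * b * norm v" if "a \<in> K" for a
    proof -
      have "\<bar>a \<bullet> v\<bar> \<le> norm v" using Cauchy_Schwarz_ineq2[of a v] norm_K[OF that] by simp
      then have "real k * \<bar>h a\<bar> * \<bar>a \<bullet> v\<bar> \<le> real k * b * norm v"
        using inverse_power(2)[OF that] by (intro mult_mono) auto
      then show ?thesis by (simp add: abs_mult)
    qed
  qed (use inverse_power(1) in measurable)
  ultimately show ?case by blast
next
  case (add f g)
  then obtain D E where D: "\<forall>x\<in>Omega K. (f has_derivative (\<lambda>v. D v x)) (at x)" "\<forall>v. Phi_class (D v)"
    and E: "\<forall>x\<in>Omega K. (g has_derivative (\<lambda>v. E v x)) (at x)" "\<forall>v. Phi_class (E v)" by blast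
  then show ?case
    by (intro exI[of _ "\<lambda>v x. D v x + E v x"]) (auto intro!: has_derivative_add Phi_class.add)
next
  case (mult f g)
  then obtain D E where D: "\<forall>x\<in>Omega K. (f has_derivative (\<lambda>v. D v x)) (at x)" "\<forall>v. Phi_class (D v)"
    and E: "\<forall>x\<in>Omega K. (g has_derivative (\<lambda>v. E v x)) (at x)" "\<forall>v. Phi_class (E v)" by blast
  then show ?case
    using mult.hyps
    by (intro exI[of _ "\<lambda>v x. f x * E v x + D v x * g x"])
       (auto intro!: has_derivative_mult Phi_class.add Phi_class.mult)
qed

lemma smooth_Phi: "smooth_on (Omega K) (Phi K \<mu>)"
  by (rule smooth_on_coinduct[where \<F>=Phi_class, OF open_Omega_K Phi_class_derivative Phi_class.Phi])

lemma log_Phi_gradient: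
  assumes "x \<in> Omega K"
  shows "(log_Phi has_derivative (\<lambda>v. v \<bullet> g_mu \<mu> x)) (at x)"
  using log_Phi_derivative(2)[OF assms] by (simp add: inner_g_mu[OF Omega_g_defined[OF assms]])

lemma log_Phi_scale:
  assumes x: "x \<in> Omega K" and t: "t > 0"
  shows "log_Phi (t *\<^sub>R x) = ln t + log_Phi x"
proof -
  have "log_Phi (t *\<^sub>R x) = (\<integral>a. ln t + ln \<bar>a \<bullet> x\<bar> \<partial>\<mu>)"
    unfolding log_Phi_def
  proof (rule integral_cong_AE)
    show "AE a in \<mu>. ln \<bar>a \<bullet> t *\<^sub>R x\<bar> = ln t + ln \<bar>a \<bullet> x\<bar>"
      using AE_K
    proof eventually_elim
      case (elim a)
      then show ?case using Omega_nonzero[OF x elim] t by (simp add: abs_mult ln_mult)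
    qed
  qed auto
  also have "\<dots> = ln t + log_Phi x"
    using log_Phi_derivative(1)[OF x] \<mu>.prob_space by (simp add: log_Phi_def)
  finally show ?thesis .
qed

lemma Phi_scale:
  assumes "x \<in> Omega K" "t > 0"
  shows "Phi K \<mu> (t *\<^sub>R x) = t * Phi K \<mu> x"
  using assms by (simp add: Phi_eq log_Phi_scale exp_add)

section \<open>Tangent hyperplanes of level sets\<close>

text \<open>
  Differentiating the constant \<open>log_Phi (\<gamma> t)\<close> shows that velocities of curves in the level set are
  orthogonal to the gradient. Conversely, for \<open>v\<close> orthogonal to \<open>g_mu \<mu> u\<close>, the curve
  \<open>\<gamma> t = (Phi K \<mu> u / Phi K \<mu> (u + t *\<^sub>R v)) *\<^sub>R (u + t *\<^sub>R v)\<close> runs in the level set by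
  homogeneity, and its scaling factor has derivative \<open>- (v \<bullet> g_mu \<mu> u) = 0\<close> at \<open>t = 0\<close>, so its
  velocity there is \<open>v\<close>.
\<close>

lemma affine_tangent_space_level:
  assumes u: "u \<in> Omega K"
  shows "affine_tangent_space (level_hypersurface K \<mu> u) u = {y. g_mu \<mu> u \<bullet> y = 1}"
proof (intro set_eqI iffI)
  fix y assume "y \<in> affine_tangent_space (level_hypersurface K \<mu> u) u"
  then obtain \<gamma> \<epsilon> where y: "y = u + vector_derivative \<gamma> (at 0)" and \<epsilon>: "\<epsilon> > 0"
    and C1: "\<gamma> C1_differentiable_on {-\<epsilon><..<\<epsilon>}" and \<gamma>0: "\<gamma> 0 = u"
    and \<gamma>: "\<gamma> ` {-\<epsilon><..<\<epsilon>} \<subseteq> level_hypersurface K \<mu> u"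
    by (auto simp: affine_tangent_space_def)
  define w where "w = vector_derivative \<gamma> (at 0)"
  have w: "(\<gamma> has_vector_derivative w) (at 0)"
  proof -
    from C1 \<epsilon> obtain d where "(\<gamma> has_vector_derivative d) (at 0)"
      unfolding C1_differentiable_on_def by force
    then show ?thesis unfolding w_def by (simp add: vector_derivative_at)
  qed
  have "((\<lambda>t. log_Phi (\<gamma> t)) has_derivative (\<lambda>t. (t *\<^sub>R w) \<bullet> g_mu \<mu> u)) (at 0)"
    using has_derivative_compose[OF w[unfolded has_vector_derivative_def], of log_Phi "\<lambda>v. v \<bullet> g_mu \<mu> u"] log_Phi_gradient[OF u]
    by (simp add: \<gamma>0)
  moreover have "((\<lambda>t. log_Phi (\<gamma> t)) has_derivative (\<lambda>t. 0)) (at 0)"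
  proof (rule has_derivative_transform_within_open[OF _ open_greaterThanLessThan])
    show "((\<lambda>t::real. log_Phi u) has_derivative (\<lambda>t. 0)) (at 0)" by simp
    show "log_Phi u = log_Phi (\<gamma> t)" if "t \<in> {-\<epsilon><..<\<epsilon>}" for t
      using subsetD[OF \<gamma> imageI[OF that]] by (simp add: level_hypersurface_def Phi_eq)
  qed (use \<epsilon> in auto)
  ultimately have "(\<lambda>t. (t *\<^sub>R w) \<bullet> g_mu \<mu> u) = (\<lambda>t. 0)"
    by (rule has_derivative_unique)
  from fun_cong[OF this, of 1] have "w \<bullet> g_mu \<mu> u = 0" by simp
  then show "y \<in> {y. g_mu \<mu> u \<bullet> y = 1}"
    using inner_g_mu_self[OF Omega_g_defined[OF u]]
    by (simp add: y w_def[symmetric] inner_add_right inner_commute)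
next
  fix y assume "y \<in> {y. g_mu \<mu> u \<bullet> y = 1}"
  define v where "v = y - u"
  have v: "v \<bullet> g_mu \<mu> u = 0"
    using \<open>y \<in> {y. g_mu \<mu> u \<bullet> y = 1}\<close> inner_g_mu_self[OF Omega_g_defined[OF u]]
    by (simp add: v_def inner_diff_left inner_commute[of y])
  obtain r where r: "r > 0" "ball u r \<subseteq> Omega K"
    using open_Omega_K u by (meson openE)
  \<comment> \<open>The summand 1 covers the case \<open>v = 0\<close>.\<close>
  define \<epsilon> where "\<epsilon> = r / (norm v + 1)"
  have nv: "norm v + 1 > 0" by (simp add: add_nonneg_pos)
  have \<epsilon>: "\<epsilon> > 0" using r(1) nv by (simp add: \<epsilon>_def)
  define p where "p t = u + t *\<^sub>R v" for t
  have p: "p t \<in> Omega K" if "t \<in> {-\<epsilon><..<\<epsilon>}" for t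
  proof -
    have "\<bar>t\<bar> * norm v \<le> \<bar>t\<bar> * (norm v + 1)" by (intro mult_left_mono) auto
    also have "\<dots> < r"
    proof -
      have "\<bar>t\<bar> < \<epsilon>" using that by auto
      then show ?thesis using nv by (simp add: \<epsilon>_def pos_less_divide_eq)
    qed
    finally have "p t \<in> ball u r" by (simp add: p_def dist_norm)
    then show ?thesis using r(2) by blast
  qed
  define e where "e t = exp (log_Phi u - log_Phi (p t))" for t
  define \<gamma> where "\<gamma> t = e t *\<^sub>R p t" for t
  define D where "D t = e t *\<^sub>R v + (e t * - (v \<bullet> g_mu \<mu> (p t))) *\<^sub>R p t" for t
  have p': "(p has_vector_derivative v) (at t)" for t
    unfolding p_def by (auto intro!: derivative_eq_intros)
  have L: "((\<lambda>t. log_Phi (p t)) has_real_derivative v \<bullet> g_mu \<mu> (p t)) (at t)" if "t \<in> {-\<epsilon><..<\<epsilon>}" for t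
    using has_derivative_compose[OF p'[unfolded has_vector_derivative_def] log_Phi_gradient[OF p[OF that]]]
    by (simp add: has_field_derivative_def mult_commute_abs)
  have e': "(e has_real_derivative e t * - (v \<bullet> g_mu \<mu> (p t))) (at t)" if "t \<in> {-\<epsilon><..<\<epsilon>}" for t
    unfolding e_def using L[OF that] by (auto intro!: derivative_eq_intros)
  have \<gamma>': "(\<gamma> has_vector_derivative D t) (at t)" if "t \<in> {-\<epsilon><..<\<epsilon>}" for t
    unfolding \<gamma>_def D_def using has_vector_derivative_scaleR[OF e'[OF that] p'] by simp
  have "continuous_on {-\<epsilon><..<\<epsilon>} D"
  proof -
    have p_cont: "continuous_on {-\<epsilon><..<\<epsilon>} p" unfolding p_def by (intro continuous_intros)
    have e_cont: "continuous_on {-\<epsilon><..<\<epsilon>} e"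
      using e' by (intro continuous_at_imp_continuous_on ballI DERIV_isCont) auto
    have "continuous_on (Omega K) (\<lambda>x. \<integral>a. (a \<bullet> v) / (a \<bullet> x) ^ 1 \<partial>\<mu>)"
    proof (intro continuous_at_imp_continuous_on ballI has_derivative_continuous)
      fix x assume "x \<in> Omega K"
      then show "((\<lambda>x. \<integral>a. (a \<bullet> v) / (a \<bullet> x) ^ 1 \<partial>\<mu>) has_derivative
          (\<lambda>w. \<integral>a. (- real 1 * (a \<bullet> v) * (a \<bullet> w)) / (a \<bullet> x) ^ Suc 1 \<partial>\<mu>)) (at x)"
      proof (rule inverse_power_integral_derivative)
        show "\<bar>a \<bullet> v\<bar> \<le> norm v" if "a \<in> K" for a
          using Cauchy_Schwarz_ineq2[of a v] norm_K[OF that] by simp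
      qed measurable
    qed
    then have "continuous_on (Omega K) (\<lambda>x. v \<bullet> g_mu \<mu> x)"
      by (rule continuous_on_eq) (simp add: inner_g_mu[OF Omega_g_defined])
    then have "continuous_on {-\<epsilon><..<\<epsilon>} (\<lambda>t. v \<bullet> g_mu \<mu> (p t))"
      by (rule continuous_on_compose2[OF _ p_cont]) (use p in auto)
    then show ?thesis
      unfolding D_def
      by (intro continuous_on_add continuous_on_scaleR continuous_on_mult continuous_on_minus
          continuous_on_const p_cont e_cont)
  qed
  with \<gamma>' have C1: "\<gamma> C1_differentiable_on {-\<epsilon><..<\<epsilon>}"
    unfolding C1_differentiable_on_def by blast
  have "\<gamma> t \<in> level_hypersurface K \<mu> u" if "t \<in> {-\<epsilon><..<\<epsilon>}" for t
  proof -
    have "e t > 0" by (simp add: e_def)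
    then have "Phi K \<mu> (\<gamma> t) = e t * Phi K \<mu> (p t)" "\<gamma> t \<in> Omega K"
      unfolding \<gamma>_def using p[OF that] by (auto intro: Phi_scale Omega_scale)
    moreover have "e t * Phi K \<mu> (p t) = Phi K \<mu> u"
      by (simp add: e_def Phi_eq exp_diff)
    ultimately show ?thesis by (simp add: level_hypersurface_def)
  qed
  moreover have "\<gamma> 0 = u" by (simp add: \<gamma>_def e_def p_def)
  moreover have "vector_derivative \<gamma> (at 0) = v"
    using vector_derivative_at[OF \<gamma>'[of 0]] \<epsilon> v by (simp add: D_def e_def p_def)
  ultimately show "y \<in> affine_tangent_space (level_hypersurface K \<mu> u) u"
    unfolding affine_tangent_space_def using \<epsilon> C1
    by (intro CollectI exI[of _ \<gamma>] exI[of _ \<epsilon>]) (auto simp: v_def)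
qed

end

context null_directions
begin

lemma distributed_H_mu:
  assumes "DIM('a) \<ge> 2" and U [measurable]: "U \<in> borel_measurable P"
    and law: "distr P borel U = uniform_sphere"
  shows "distributed P lborel (\<lambda>\<omega>. H_mu \<mu> (U \<omega>))
    (\<lambda>x. ennreal (beta_density (1 / 2) ((real DIM('a) - 1) / 2) x))"
proof -
  have "distr P lborel (\<lambda>\<omega>. H_mu \<mu> (U \<omega>)) = distr P borel (\<lambda>\<omega>. H_mu \<mu> (U \<omega>))"
    by (rule distr_cong) auto
  also have "\<dots> = distr (distr P borel U) borel (H_mu \<mu>)"
    by (subst distr_distr) (auto simp: comp_def)
  also have "\<dots> = density lborel (\<lambda>x. ennreal (beta_density (1 / 2) ((real DIM('a) - 1) / 2) x))"
    unfolding law by (rule distr_sphere_H_mu[OF assms(1)])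
  finally show ?thesis unfolding distributed_def by auto
qed

lemma AE_sphere_tangent_hyperplane:
  "AE u in uniform_sphere. u \<in> Omega K \<and> g_defined \<mu> u \<and>
    affine (affine_tangent_space (level_hypersurface K \<mu> u) u) \<and>
    aff_dim (affine_tangent_space (level_hypersurface K \<mu> u) u) = int DIM('a) - 1 \<and>
    H_mu \<mu> u = (u \<bullet> N_mu \<mu> u)\<^sup>2 \<and>
    H_mu \<mu> u = (infdist 0 (affine_tangent_space (level_hypersurface K \<mu> u) u))\<^sup>2"
  using AE_Omega_K(3)
proof eventually_elim
  case (elim u)
  note g = Omega_g_defined[OF elim]
  show ?case
    using g_mu_nonzero[OF g]
    by (simp add: elim g affine_tangent_space_level affine_hyperplane H_mu_eq_cosine[OF g, symmetric]
        infdist_origin_hyperplane H_mu_def power_divide)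
qed

end

theorem corollary8p8:
  fixes K :: "(real ^ 'p) set" and \<mu> :: "(real ^ 'p) measure"
  assumes "CARD('p) \<ge> 2"
    and "K \<subseteq> sphere 0 1" and "compact K" and "hausdorff1 K = 0"
    and "prob_space \<mu>" and "sets \<mu> = sets borel" and "emeasure \<mu> (- K) = 0"
  shows
    "orthogonality_shadow K \<in> null_sets uniform_sphere
     \<and>
     \<comment> \<open>(1)\<close>
     ((AE u in uniform_sphere. g_defined \<mu> u) \<and>
      (\<forall>u. g_defined \<mu> u \<longrightarrow> u \<bullet> g_mu \<mu> u = 1) \<and>
      (\<forall>u \<in> sphere 0 1. g_defined \<mu> u \<longrightarrow> H_mu \<mu> u = (u \<bullet> N_mu \<mu> u)\<^sup>2) \<and>
      (\<forall>(P :: 'w measure) U.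
         prob_space P \<and> U \<in> borel_measurable P \<and> distr P borel U = uniform_sphere \<longrightarrow>
         (AE \<omega> in P. g_defined \<mu> (U \<omega>) \<and> H_mu \<mu> (U \<omega>) = (U \<omega> \<bullet> N_mu \<mu> (U \<omega>))\<^sup>2) \<and>
         distributed P lborel (\<lambda>\<omega>. H_mu \<mu> (U \<omega>))
           (\<lambda>x. ennreal (beta_density (1 / 2) ((real CARD('p) - 1) / 2) x))))
     \<and>
     \<comment> \<open>(2)\<close>
     (open (Omega K) \<and>
      (\<forall>x \<in> Omega K. \<forall>t > 0. t *\<^sub>R x \<in> Omega K) \<and>
      smooth_on (Omega K) (Phi K \<mu>) \<and>
      (\<forall>x \<in> Omega K. \<forall>t > 0. Phi K \<mu> (t *\<^sub>R x) = t * Phi K \<mu> x) \<and>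
      (\<forall>x \<in> Omega K. g_defined \<mu> x \<and> GDERIV (\<lambda>y. ln (Phi K \<mu> y)) x :> g_mu \<mu> x))
     \<and>
     \<comment> \<open>(3)\<close>
     (AE u in uniform_sphere.
        u \<in> Omega K \<and> g_defined \<mu> u \<and>
        affine (affine_tangent_space (level_hypersurface K \<mu> u) u) \<and>
        aff_dim (affine_tangent_space (level_hypersurface K \<mu> u) u) = int CARD('p) - 1 \<and>
        H_mu \<mu> u = (u \<bullet> N_mu \<mu> u)\<^sup>2 \<and>
        H_mu \<mu> u = (infdist 0 (affine_tangent_space (level_hypersurface K \<mu> u) u))\<^sup>2)"
proof -
  interpret null_directions K \<mu>
    by (rule null_directions.intro) (fact assms)+
  have dim: "DIM(real ^ 'p) = CARD('p)" by simp
  have AE_g: "AE u in uniform_sphere. g_defined \<mu> u"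
    using AE_Omega_K(3) by eventually_elim (rule Omega_g_defined)
  have "AE \<omega> in P. g_defined \<mu> (U \<omega>) \<and> H_mu \<mu> (U \<omega>) = (U \<omega> \<bullet> N_mu \<mu> (U \<omega>))\<^sup>2"
    and "distributed P lborel (\<lambda>\<omega>. H_mu \<mu> (U \<omega>))
      (\<lambda>x. ennreal (beta_density (1 / 2) ((real CARD('p) - 1) / 2) x))"
    if U: "U \<in> borel_measurable P" and law: "distr P borel U = uniform_sphere"
    for P :: "'w measure" and U
  proof -
    have "AE u in distr P borel U. g_defined \<mu> u"
      unfolding law by (rule AE_g)
    then have "AE \<omega> in P. g_defined \<mu> (U \<omega>)"
      using U by (subst (asm) AE_distr_iff) auto
    then show "AE \<omega> in P. g_defined \<mu> (U \<omega>) \<and> H_mu \<mu> (U \<omega>) = (U \<omega> \<bullet> N_mu \<mu> (U \<omega>))\<^sup>2"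
      by eventually_elim (simp add: H_mu_eq_cosine)
    show "distributed P lborel (\<lambda>\<omega>. H_mu \<mu> (U \<omega>))
      (\<lambda>x. ennreal (beta_density (1 / 2) ((real CARD('p) - 1) / 2) x))"
      using distributed_H_mu[OF _ U law] assms(1) by (simp only: dim)
  qed
  moreover have "GDERIV (\<lambda>y. ln (Phi K \<mu> y)) x :> g_mu \<mu> x" if "x \<in> Omega K" for x
    using log_Phi_gradient[OF that] by (simp add: gderiv_def Phi_eq)
  ultimately show ?thesis
    using orthogonality_shadow_null[OF K_compact K_nonempty K_sphere K_null] AE_g
      open_Omega_K smooth_Phi AE_sphere_tangent_hyperplane[unfolded dim]
    by (intro conjI allI ballI impI)
      (auto intro: inner_g_mu_self H_mu_eq_cosine Omega_scale Phi_scale Omega_g_defined)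
qed

end
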